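(* Let $d\ge 1$, let $p_1,\dots,p_d\ge 1$ be integers with $\gcd(p_i,p_j)=1$ for $1\le i<j\le d$ and $p_1p_2\cdots p_d\ge 2$, and let $r\in(0,1)$. Put $\mathbf p=(p_1,\dots,p_d)$. Then: 1. For every $\beta\in\mathbb R$, the free energy function $F_r(\beta)$ associated to the multiple sum $S^{\mathbf p}_{N_1\times\cdots\times N_d}$ (the limit defining it exists and) is given by $$F_r(\beta)=\frac{2p_1\cdots p_d-1}{2p_1\cdots p_d}\log\big(r(1-r)\big)+\frac{p_1\cdots p_d-1}{p_1\cdots p_d}\log|v^T\cdot e_+|^2+\log\Lambda_++\mathcal G(\beta),$$ where $$\mathcal G(\beta)=\sum_{\ell=1}^{\infty}\frac{(p_1\cdots p_d-1)^2}{(p_1\cdots p_d)^{\ell+1}}\log\left(1+\left(\frac{2\cosh(h)}{|v^T\cdot e_+|^2}-1\right)\left(\frac{\Lambda_-}{\Lambda_+}\right)^{\ell}\right).$$ 2. The function $\beta\mapsto F_r(\beta)$ is differentiable on $\mathbb R$. 3. The multiple average $\dfrac{S^{\mathbf p}_{N_1\times\cdots\times N_d}}{N_1\cdots N_d}$ satisfies a large deviation principle with the rate function $$I_r(x)=\sup_{\beta\in\mathbb R}\big(\beta x-F_r(\beta)\big).$$ Furthermore, if $F_r'(\eta)=y$, then $I_r(y)=\eta y-F_r(\eta)$.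
   Context: Let $\mathcal A=\{+1,-1\}$ and let $\mathbb N=\{1,2,\dots\}$. $\mathbb P_r$ is the product Bernoulli measure on $\mathcal A^{\mathbb N^d}$ under which the spins $\sigma_{\mathbf i}$, $\mathbf i\in\mathbb N^d$, are i.i.d. with $\mathbb P_r(\sigma_{\mathbf i}=+1)=r$, $\mathbb P_r(\sigma_{\mathbf i}=-1)=1-r$; $\mathbb E_r$ is its expectation. For $\mathbf i=(i_1,\dots,i_d)$ write $\mathbf p\cdot\mathbf i=(p_1i_1,\dots,p_di_d)$ (coordinatewise product). The multiple sum is $$S^{\mathbf p}_{N_1\times\cdots\times N_d}(\sigma)=\sum_{i_1=1}^{N_1}\cdots\sum_{i_d=1}^{N_d}\sigma_{\mathbf i}\,\sigma_{\mathbf p\cdot\mathbf i}.$$ The notation $\mathbf N\to\infty$ means $N_1,\dots,N_d\to\infty$. The free energy function is $$F_r(\beta)=\lim_{\mathbf N\to\infty}\frac1{N_1\cdots N_d}\log\mathbb E_r\big(\exp(\beta S^{\mathbf p}_{N_1\times\cdots\times N_d})\big),$$ and the large deviation rate function of the multiple average is $$I_r(x)=\lim_{\varepsilon\to0}\lim_{\mathbf N\to\infty}-\frac1{N_1\cdots N_d}\log\mathbb P_r\left(\frac{S^{\mathbf p}_{N_1\times\cdots\times N_d}}{N_1\cdots N_d}\in[x-\varepsilon,x+\varepsilon]\right).$$ The large deviation principle is with speed $N_1\cdots N_d$. Further notation: $h=\frac12\log\frac{r}{1-r}$; $v^T=(e^{h/2},e^{-h/2})$; $$\Lambda_\pm=e^{\beta}\left(\cosh(h)\pm\sqrt{\sinh^2(h)+e^{-4\beta}}\right),$$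 the eigenvalues of the matrix $\begin{pmatrix}e^{\beta+h}&e^{-\beta}\\ e^{-\beta}&e^{\beta-h}\end{pmatrix}$; and $e_+=w_+/\|w_+\|$ (Euclidean norm) with $w_+=\begin{pmatrix}-e^{-\beta}\\ e^{h+\beta}-\Lambda_+\end{pmatrix}$, a normalized eigenvector for $\Lambda_+$. $v^T\cdot e_+$ is the usual inner product. *)

theory Defs
  imports "HOL-Probability.Probability"
begin

text \<open>
  The dimension is the cardinality of a finite index type \<open>'d\<close>; multi-indices are functions
  \<open>'d \<Rightarrow> nat\<close>. The positive integers are the naturals \<open>\<ge> 1\<close>.
\<close>

type_synonym 'd index = "'d \<Rightarrow> nat"

definition pos_indices :: "('d::finite) index set" where
  "pos_indices = {i. \<forall>j. 1 \<le> i j}"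

definition index_box :: "('d::finite) index \<Rightarrow> 'd index set" where
  "index_box N = {i. \<forall>j. i j \<in> {1..N j}}"

definition box_volume :: "('d::finite) index \<Rightarrow> real" where
  "box_volume N = (\<Prod>j\<in>UNIV. real (N j))"

text \<open>The filter of \<open>N\<^sub>1, \<dots>, N\<^sub>d \<rightarrow> \<infinity>\<close>, jointly and at unrelated speeds.\<close>

definition boxes_at_top :: "('d::finite) index filter" where
  "boxes_at_top = (INF j. filtercomap (\<lambda>N. N j) at_top)"

definition spin_measure :: "real \<Rightarrow> real measure" where
  "spin_measure r = point_measure {1, -1} (\<lambda>s. ennreal (if s = 1 then r else 1 - r))"

definition bernoulli_field :: "real \<Rightarrow> (('d::finite) index \<Rightarrow> real) measure" where
  "bernoulli_field r = PiM pos_indices (\<lambda>_. spin_measure r)"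

definition multiple_sum ::
    "('d::finite) index \<Rightarrow> 'd index \<Rightarrow> ('d index \<Rightarrow> real) \<Rightarrow> real" where
  "multiple_sum p N \<sigma> = (\<Sum>i\<in>index_box N. \<sigma> i * \<sigma> (\<lambda>j. p j * i j))"

definition multiple_average ::
    "('d::finite) index \<Rightarrow> 'd index \<Rightarrow> ('d index \<Rightarrow> real) \<Rightarrow> real" where
  "multiple_average p N \<sigma> = multiple_sum p N \<sigma> / box_volume N"

definition finite_free_energy ::
    "real \<Rightarrow> ('d::finite) index \<Rightarrow> 'd index \<Rightarrow> real \<Rightarrow> real" where
  "finite_free_energy r p N \<beta> =
     ln (LINT \<sigma>|bernoulli_field r. exp (\<beta> * multiple_sum p N \<sigma>)) / box_volume N"

definition free_energy :: "real \<Rightarrow> ('d::finite) index \<Rightarrow> real \<Rightarrow> real" where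
  "free_energy r p \<beta> = Lim boxes_at_top (\<lambda>N. finite_free_energy r p N \<beta>)"


text \<open>Logarithm of a nonnegative real with \<open>log 0 = -\<infinity>\<close> (whereas \<open>ln 0 = 0\<close> in HOL).\<close>

definition log_ext :: "real \<Rightarrow> ereal" where
  "log_ext x = (if x \<le> 0 then - \<infinity> else ereal (ln x))"

definition window_rate ::
    "real \<Rightarrow> ('d::finite) index \<Rightarrow> real \<Rightarrow> real \<Rightarrow> 'd index \<Rightarrow> ereal" where
  "window_rate r p x \<epsilon> N =
     - log_ext (measure (bernoulli_field r)
         {\<sigma> \<in> space (bernoulli_field r). multiple_average p N \<sigma> \<in> {x - \<epsilon>..x + \<epsilon>}})
       / ereal (box_volume N)"

definition window_rate_limit ::
    "real \<Rightarrow> ('d::finite) index \<Rightarrow> real \<Rightarrow> real \<Rightarrow> ereal" where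
  "window_rate_limit r p x \<epsilon> = Lim boxes_at_top (window_rate r p x \<epsilon>)"

definition rate_function :: "real \<Rightarrow> ('d::finite) index \<Rightarrow> real \<Rightarrow> ereal" where
  "rate_function r p x = Lim (at_right 0) (window_rate_limit r p x)"

text \<open>
  The large deviation principle in the usual (Dembo--Zeitouni) form, for real random
  variables \<open>X n\<close> on \<open>M\<close>, with speed \<open>a n\<close> along the filter \<open>F\<close>; the rate function is
  nonnegative and lower semicontinuous.
\<close>

definition large_deviation_principle ::
    "'i filter \<Rightarrow> ('i \<Rightarrow> real) \<Rightarrow> 'a measure \<Rightarrow> ('i \<Rightarrow> 'a \<Rightarrow> real) \<Rightarrow> (real \<Rightarrow> ereal) \<Rightarrow> bool" where
  "large_deviation_principle F a M X I \<longleftrightarrow>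
     (\<forall>n. X n \<in> borel_measurable M) \<and>
     (\<forall>x. 0 \<le> I x) \<and>
     (\<forall>c::real. closed {x. I x \<le> ereal c}) \<and>
     (\<forall>A\<in>sets borel.
        - (INF x\<in>interior A. I x)
          \<le> Liminf F (\<lambda>n. log_ext (measure M {\<omega> \<in> space M. X n \<omega> \<in> A}) / ereal (a n)) \<and>
        Limsup F (\<lambda>n. log_ext (measure M {\<omega> \<in> space M. X n \<omega> \<in> A}) / ereal (a n))
          \<le> - (INF x\<in>closure A. I x))"


definition ext_field :: "real \<Rightarrow> real" where
  "ext_field r = ln (r / (1 - r)) / 2"

definition v_vec :: "real \<Rightarrow> real^2" where
  "v_vec h = vector [exp (h / 2), exp (- h / 2)]"

definition Lambda_plus :: "real \<Rightarrow> real \<Rightarrow> real" where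
  "Lambda_plus h \<beta> = exp \<beta> * (cosh h + sqrt ((sinh h)^2 + exp (- 4 * \<beta>)))"

definition Lambda_minus :: "real \<Rightarrow> real \<Rightarrow> real" where
  "Lambda_minus h \<beta> = exp \<beta> * (cosh h - sqrt ((sinh h)^2 + exp (- 4 * \<beta>)))"

definition w_plus :: "real \<Rightarrow> real \<Rightarrow> real^2" where
  "w_plus h \<beta> = vector [- exp (- \<beta>), exp (h + \<beta>) - Lambda_plus h \<beta>]"

definition e_plus :: "real \<Rightarrow> real \<Rightarrow> real^2" where
  "e_plus h \<beta> = w_plus h \<beta> /\<^sub>R norm (w_plus h \<beta>)"

definition index_prod :: "('d::finite) index \<Rightarrow> real" where
  "index_prod p = real (\<Prod>j\<in>UNIV. p j)"

definition G_term :: "real \<Rightarrow> ('d::finite) index \<Rightarrow> real \<Rightarrow> nat \<Rightarrow> real" where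
  "G_term r p \<beta> l =
     (let h = ext_field r; P = index_prod p in
      (P - 1)^2 / P ^ (l + 1) *
      ln (1 + (2 * cosh h / \<bar>v_vec h \<bullet> e_plus h \<beta>\<bar>^2 - 1)
               * (Lambda_minus h \<beta> / Lambda_plus h \<beta>) ^ l))"

text \<open>The sum runs over \<open>l \<ge> 1\<close>.\<close>

definition G_series :: "real \<Rightarrow> ('d::finite) index \<Rightarrow> real \<Rightarrow> real" where
  "G_series r p \<beta> = (\<Sum>l. G_term r p \<beta> (Suc l))"

end

(* The sites of the box split into chains i, p i, p^2 i, ... starting at the indices that are not
   multiples of p.  The multiple sum couples only neighbours on a chain, so distinct chains are
   independent and E exp(beta S) is a product of partition functions Z_l of one-dimensional open
   Ising chains with l bonds.  In the limit a fraction (P - 1)^2 / P^(l + 1) of the sites, with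
   P = p_1 ... p_d, are starting points of chains with exactly l bonds, and |log Z_l| <= l |beta|;
   dominated convergence gives F = sum_l (P - 1)^2 / P^(l + 1) log Z_l.  The transfer matrix makes Z_l
   explicit, and |(log Z_l)'| <= l makes F differentiable.  The large deviation principle is then
   the one-dimensional Gaertner-Ellis theorem. *)
theory Submission
  imports Defs
begin

section \<open>The Gaertner-Ellis theorem for bounded real variables\<close>

text \<open>Two obstacles shape the proof. The first is the boundary of a window: upper bounds on
  probabilities are governed by the closed window, lower bounds by its interior. For a convex rate
  both have the same infimum unless the closed window meets the set of finite rate only in an
  endpoint. For fixed x this is impossible once \<epsilon> is small, which is why the inner limit is
  obtained eventually as \<epsilon> tends to 0. The second is that tilting gives a lower bound only
  at slopes of F, and these are not known explicitly. Finiteness and differentiability of F on the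
  whole line supply them: every point strictly between two points of finite rate is a slope, and a
  boundary point is approached by moving towards F'(0), where the rate vanishes. The chain densities
  are second differences of volumes. The sites i with p^(l-1) i in the box have density 1 / P^(l-1);
  one difference discards those whose chain goes on inside the box, another those that are not
  starting points.\<close>

definition legendre :: "(real \<Rightarrow> real) \<Rightarrow> real \<Rightarrow> ereal" where
  "legendre L x = (SUP \<beta>. ereal (\<beta> * x - L \<beta>))"

lemma legendre_le_iff: "legendre L x \<le> ereal c \<longleftrightarrow> (\<forall>\<beta>. \<beta> * x - L \<beta> \<le> c)"
  by (simp add: legendre_def SUP_le_iff)

lemma less_legendre_iff: "ereal c < legendre L x \<longleftrightarrow> (\<exists>\<beta>. c < \<beta> * x - L \<beta>)"
  by (simp add: legendre_def less_SUP_iff)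

text \<open>A supremum of affine functions is convex. Real upper bounds stand for the values, so no
  arithmetic with infinite values occurs.\<close>

lemma legendre_convex:
  assumes "legendre L x \<le> ereal c" "legendre L y \<le> ereal d" "0 \<le> t" "t \<le> 1"
  shows "legendre L ((1 - t) * x + t * y) \<le> ereal ((1 - t) * c + t * d)"
  unfolding legendre_le_iff
proof
  fix \<beta>
  have "(1 - t) * (\<beta> * x - L \<beta>) + t * (\<beta> * y - L \<beta>) \<le> (1 - t) * c + t * d"
    using assms by (intro add_mono mult_left_mono) (auto simp: legendre_le_iff)
  then show "\<beta> * ((1 - t) * x + t * y) - L \<beta> \<le> (1 - t) * c + t * d"
    by (simp add: algebra_simps)
qed

text \<open>Each affine function has a closed sublevel set, and the supremum has their
  intersection.\<close>

lemma closed_legendre_sublevel: "closed {x. legendre L x \<le> ereal c}"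
  unfolding legendre_le_iff
  by (intro closed_Collect_all closed_Collect_le continuous_intros)

text \<open>This and its mirror image trade extended logarithms for exponential bounds on
  probabilities, which remain meaningful when the probability is 0.\<close>

lemma log_ext_div_le_iff:
  assumes "0 < V"
  shows "log_ext P / ereal V \<le> ereal c \<longleftrightarrow> P \<le> exp (V * c)"
proof (cases "P \<le> 0")
  case True
  then show ?thesis using assms order.trans[OF True less_imp_le[OF exp_gt_zero]]
    by (simp add: log_ext_def)
next
  case False
  then show ?thesis
    using assms by (simp add: log_ext_def field_simps flip: ln_ge_iff)
      (metis exp_le_cancel_iff exp_ln mult.commute not_le)
qed

lemma le_log_ext_div_iff:
  assumes "0 < V"
  shows "ereal c \<le> log_ext P / ereal V \<longleftrightarrow> exp (V * c) \<le> P"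
proof (cases "P \<le> 0")
  case True
  then show ?thesis using assms order.strict_trans1[OF True exp_gt_zero[of "V * c"]]
    by (simp add: log_ext_def)
next
  case False
  then show ?thesis
    using assms by (simp add: log_ext_def field_simps)
      (metis exp_le_cancel_iff exp_ln mult.commute not_le)
qed

text \<open>The bound on \<open>X n\<close> makes exponential tightness automatic: all mass lies in
  the compact interval [-1, 1]. Since \<open>L\<close> is finite on the whole line, its domain has
  no boundary at which steepness could fail.\<close>

locale gartner_ellis = prob_space M
  for M :: "'a measure" +
  fixes F :: "'i filter" and a :: "'i \<Rightarrow> real" and X :: "'i \<Rightarrow> 'a \<Rightarrow> real" and L :: "real \<Rightarrow> real"
  assumes F_nontrivial: "F \<noteq> bot"
    and speed: "filterlim a at_top F"
    and X_measurable [measurable]: "\<And>n. X n \<in> borel_measurable M"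
    and X_bounded: "\<And>n \<omega>. \<omega> \<in> space M \<Longrightarrow> \<bar>X n \<omega>\<bar> \<le> 1"
    and L_lim: "\<And>\<beta>. ((\<lambda>n. ln (LINT \<omega>|M. exp (\<beta> * (a n * X n \<omega>))) / a n) \<longlongrightarrow> L \<beta>) F"
    and L_differentiable: "\<And>\<beta>. L differentiable (at \<beta>)"
begin

section \<open>Exponential moments and convexity of their limit\<close>

definition mgf :: "'i \<Rightarrow> real \<Rightarrow> real" where
  "mgf n \<beta> = (LINT \<omega>|M. exp (\<beta> * (a n * X n \<omega>)))"

lemma exp_bound:
  assumes "\<omega> \<in> space M"
  shows "exp (\<beta> * (a n * X n \<omega>)) \<le> exp (\<bar>\<beta> * a n\<bar>)"
proof -
  have "\<beta> * (a n * X n \<omega>) \<le> \<bar>\<beta> * a n\<bar> * \<bar>X n \<omega>\<bar>"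
    by (metis abs_ge_self abs_mult mult.assoc)
  also have "\<dots> \<le> \<bar>\<beta> * a n\<bar> * 1"
    using X_bounded[OF assms] by (intro mult_left_mono) auto
  finally show ?thesis by simp
qed

lemma integrable_exp [simp]: "integrable M (\<lambda>\<omega>. exp (\<beta> * (a n * X n \<omega>)))"
  by (rule integrable_const_bound[where B = "exp (\<bar>\<beta> * a n\<bar>)"])
     (use exp_bound in \<open>auto intro!: AE_I2\<close>)

lemma integrable_exp_mult_bounded:
  assumes [measurable]: "g \<in> borel_measurable M" and "\<And>\<omega>. \<omega> \<in> space M \<Longrightarrow> \<bar>g \<omega>\<bar> \<le> 1"
  shows "integrable M (\<lambda>\<omega>. exp (\<beta> * (a n * X n \<omega>)) * g \<omega>)"
  by (rule Bochner_Integration.integrable_bound[OF integrable_exp[of \<beta> n]])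
     (auto intro!: AE_I2 mult_left_le simp: abs_mult assms)

lemma mgf_pos: "0 < mgf n \<beta>"
proof -
  have "exp (- \<bar>\<beta> * a n\<bar>) \<le> exp (\<beta> * (a n * X n \<omega>))" if "\<omega> \<in> space M" for \<omega>
    using exp_bound[OF that, of "- \<beta>" n] by simp
  then have "exp (- \<bar>\<beta> * a n\<bar>) \<le> mgf n \<beta>"
    unfolding mgf_def by (intro integral_ge_const AE_I2) auto
  then show ?thesis by (rule less_le_trans[OF exp_gt_zero])
qed

lemma mgf_0 [simp]: "mgf n 0 = 1"
  by (simp add: mgf_def prob_space)

lemma L_0: "L 0 = 0"
  using L_lim[of 0] F_nontrivial by (simp add: prob_space tendsto_const_iff)

lemma legendre_nonneg: "0 \<le> legendre L x"
  unfolding legendre_def by (rule SUP_upper2[of 0]) (auto simp: L_0)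

lemma events_X: "A \<in> sets borel \<Longrightarrow> {\<omega> \<in> space M. X n \<omega> \<in> A} \<in> events"
  using measurable_sets[OF X_measurable, of A n] by (simp add: vimage_def Int_def conj_commute)

lemma speed_gt: "eventually (\<lambda>n. c < a n) F"
  using speed by (simp add: filterlim_at_top_dense)

lemma mgf_le_eventually:
  assumes "L \<beta> < c"
  shows "eventually (\<lambda>n. mgf n \<beta> \<le> exp (a n * c)) F"
  using order_tendstoD(2)[OF L_lim assms] speed_gt[of 0]
proof eventually_elim
  case (elim n)
  then have "ln (mgf n \<beta>) \<le> a n * c" by (simp add: mgf_def field_simps)
  then show ?case using mgf_pos[of n \<beta>] by (metis exp_le_cancel_iff exp_ln)
qed

lemma mgf_ge_eventually:
  assumes "c < L \<beta>"
  shows "eventually (\<lambda>n. exp (a n * c) \<le> mgf n \<beta>) F"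
  using order_tendstoD(1)[OF L_lim assms] speed_gt[of 0]
proof eventually_elim
  case (elim n)
  then have "a n * c \<le> ln (mgf n \<beta>)" by (simp add: mgf_def field_simps)
  then show ?case using mgf_pos[of n \<beta>] by (metis exp_le_cancel_iff exp_ln)
qed

text \<open>Constant factors, such as the size of a finite cover, are absorbed by an arbitrarily
  small exponential rate.\<close>

lemma exp_speed_ge_eventually:
  assumes "0 < \<delta>"
  shows "eventually (\<lambda>n. c \<le> exp (a n * \<delta>)) F"
  using speed_gt[of "c / \<delta>"]
proof eventually_elim
  case (elim n)
  then have "c \<le> a n * \<delta>" using assms by (simp add: field_simps)
  then show ?case using exp_ge_add_one_self[of "a n * \<delta>"] by linarith
qed

text \<open>Let \<open>m\<close> be the mean of \<open>X n\<close> under the measure tilted at the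
  intermediate point \<eta>. Jensen's inequality in the form \<open>1 + u \<le> exp u\<close> gives
  a supporting line of slope \<open>a n * m\<close> at \<eta>; averaging it over \<open>u\<close>
  and \<open>v\<close> cancels the slope.\<close>

lemma mgf_log_convex:
  assumes "0 < a n" "0 \<le> t" "t \<le> 1"
  shows "ln (mgf n ((1 - t) * u + t * v)) \<le> (1 - t) * ln (mgf n u) + t * ln (mgf n v)"
proof -
  define \<eta> where "\<eta> = (1 - t) * u + t * v"
  define m where "m = (LINT \<omega>|M. exp (\<eta> * (a n * X n \<omega>)) * X n \<omega>) / mgf n \<eta>"
  have m: "(LINT \<omega>|M. exp (\<eta> * (a n * X n \<omega>)) * X n \<omega>) = m * mgf n \<eta>"
    using mgf_pos[of n \<eta>] by (simp add: m_def)
  have int: "integrable M (\<lambda>\<omega>. exp (\<eta> * (a n * X n \<omega>)) * X n \<omega>)"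
    by (intro integrable_exp_mult_bounded) (auto simp: X_bounded)
  have supp: "ln (mgf n \<eta>) + (\<beta> - \<eta>) * (a n * m) \<le> ln (mgf n \<beta>)" for \<beta>
  proof -
    let ?c = "(\<beta> - \<eta>) * a n"
    \<comment> \<open>The integrand is \<open>exp (?c * m)\<close> times the weight times
      \<open>1 + ?c * (X n \<omega> - m)\<close>, and the first-order part integrates to zero by the
      choice of \<open>m\<close>.\<close>
    have "exp (?c * m) * mgf n \<eta>
        = (LINT \<omega>|M. exp (?c * m) * ((1 - ?c * m) * exp (\<eta> * (a n * X n \<omega>))
             + ?c * (exp (\<eta> * (a n * X n \<omega>)) * X n \<omega>)))"
      using int by (simp add: m flip: mgf_def) (simp add: algebra_simps)
    also have "\<dots> \<le> mgf n \<beta>"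
      unfolding mgf_def
    proof (intro integral_mono)
      fix \<omega>
      have "exp (?c * m) * ((1 - ?c * m) * exp (\<eta> * (a n * X n \<omega>))
             + ?c * (exp (\<eta> * (a n * X n \<omega>)) * X n \<omega>))
          = exp (?c * m) * exp (\<eta> * (a n * X n \<omega>)) * (1 + ?c * (X n \<omega> - m))"
        by (simp add: algebra_simps)
      also have "\<dots> \<le> exp (?c * m) * exp (\<eta> * (a n * X n \<omega>)) * exp (?c * (X n \<omega> - m))"
        by (intro mult_left_mono exp_ge_add_one_self) auto
      also have "\<dots> = exp (\<beta> * (a n * X n \<omega>))"
        by (simp add: algebra_simps flip: exp_add)
      finally show "exp (?c * m) * ((1 - ?c * m) * exp (\<eta> * (a n * X n \<omega>))
             + ?c * (exp (\<eta> * (a n * X n \<omega>)) * X n \<omega>)) \<le> exp (\<beta> * (a n * X n \<omega>))" .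
    qed (use int in auto)
    finally have "ln (exp (?c * m) * mgf n \<eta>) \<le> ln (mgf n \<beta>)"
      using mgf_pos by simp
    then show ?thesis using mgf_pos[of n \<eta>] by (simp add: ln_mult algebra_simps)
  qed
  have "(1 - t) * (ln (mgf n \<eta>) + (u - \<eta>) * (a n * m)) + t * (ln (mgf n \<eta>) + (v - \<eta>) * (a n * m))
      \<le> (1 - t) * ln (mgf n u) + t * ln (mgf n v)"
    using assms by (intro add_mono mult_left_mono supp) auto
  moreover have "(1 - t) * (ln (mgf n \<eta>) + (u - \<eta>) * (a n * m)) + t * (ln (mgf n \<eta>) + (v - \<eta>) * (a n * m))
      = ln (mgf n \<eta>) + ((1 - t) * u + t * v - \<eta>) * (a n * m)"
    by (simp add: algebra_simps)
  ultimately show ?thesis by (simp add: \<eta>_def)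
qed

lemma L_convex: "convex_on UNIV L"
proof (intro convex_onI)
  fix t u v :: real assume t: "0 < t" "t < 1"
  have "L ((1 - t) * u + t * v) \<le> (1 - t) * L u + t * L v"
  proof (rule tendsto_le[OF F_nontrivial])
    show "((\<lambda>n. (1 - t) * (ln (mgf n u) / a n) + t * (ln (mgf n v) / a n))
            \<longlongrightarrow> (1 - t) * L u + t * L v) F"
      unfolding mgf_def by (intro tendsto_intros L_lim)
    show "((\<lambda>n. ln (mgf n ((1 - t) * u + t * v)) / a n) \<longlongrightarrow> L ((1 - t) * u + t * v)) F"
      unfolding mgf_def by (rule L_lim)
    show "eventually (\<lambda>n. ln (mgf n ((1 - t) * u + t * v)) / a n
            \<le> (1 - t) * (ln (mgf n u) / a n) + t * (ln (mgf n v) / a n)) F"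
      using speed_gt[of 0]
    proof eventually_elim
      case (elim n)
      then have "ln (mgf n ((1 - t) * u + t * v)) / a n
          \<le> ((1 - t) * ln (mgf n u) + t * ln (mgf n v)) / a n"
        using t by (intro divide_right_mono mgf_log_convex) auto
      then show ?case by (simp add: add_divide_distrib)
    qed
  qed
  then show "L ((1 - t) *\<^sub>R u + t *\<^sub>R v) \<le> (1 - t) * L u + t * L v" by simp
qed simp

text \<open>By convexity the tangent at \<eta> lies below \<open>L\<close>, so the supremum is
  attained at \<eta>.\<close>

lemma legendre_at_derivative:
  assumes "(L has_real_derivative y) (at \<eta>)"
  shows "legendre L y = ereal (\<eta> * y - L \<eta>)"
proof (rule antisym)
  show "legendre L y \<le> ereal (\<eta> * y - L \<eta>)"
    unfolding legendre_le_iff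
  proof
    fix \<beta>
    have "L \<beta> - L \<eta> \<ge> y * (\<beta> - \<eta>)"
      using assms by (intro convex_on_imp_above_tangent[OF L_convex]) auto
    then show "\<beta> * y - L \<beta> \<le> \<eta> * y - L \<eta>" by (simp add: algebra_simps)
  qed
next
  show "ereal (\<eta> * y - L \<eta>) \<le> legendre L y"
    unfolding legendre_def by (rule SUP_upper) simp
qed

section \<open>Exponential bounds on probabilities\<close>

text \<open>Exponential Chebyshev inequality: on the event, the factor
  \<open>exp (a n * (\<beta> * X n \<omega> - z))\<close> is at least 1, and multiplying by it moves
  the tilt from \<eta> to \<open>\<eta> + \<beta>\<close>. The case \<open>\<eta> = 0\<close> serves
  the upper bound; small \<beta> of either sign give concentration under the tilt.\<close>

lemma chernoff_eventually:
  assumes "L (\<eta> + \<beta>) - L \<eta> + \<kappa> < z"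
  shows "eventually (\<lambda>n. (LINT \<omega>|M. exp (\<eta> * (a n * X n \<omega>)) * indicator {\<omega>. z \<le> \<beta> * X n \<omega>} \<omega>)
           \<le> mgf n \<eta> * exp (- (a n * \<kappa>))) F"
proof -
  \<comment> \<open>Half of the gap pays for bounding the moment at \<open>\<eta> + \<beta>\<close>
    from above, the other half for bounding the one at \<eta> from below.\<close>
  define e where "e = (z - (L (\<eta> + \<beta>) - L \<eta> + \<kappa>)) / 2"
  have e: "e > 0" using assms by (simp add: e_def)
  have "L (\<eta> + \<beta>) < L (\<eta> + \<beta>) + e" "L \<eta> - e < L \<eta>" using e by auto
  from mgf_le_eventually[OF this(1)] mgf_ge_eventually[OF this(2)] speed_gt[of 0]
  show ?thesis
  proof eventually_elim
    case (elim n)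
    have "(LINT \<omega>|M. exp (\<eta> * (a n * X n \<omega>)) * indicator {\<omega>. z \<le> \<beta> * X n \<omega>} \<omega>)
       \<le> (LINT \<omega>|M. exp (- (a n * z)) * exp ((\<eta> + \<beta>) * (a n * X n \<omega>)))"
    proof (intro integral_mono)
      show "integrable M (\<lambda>\<omega>. exp (\<eta> * (a n * X n \<omega>)) * indicator {\<omega>. z \<le> \<beta> * X n \<omega>} \<omega>)"
        by (intro integrable_exp_mult_bounded) (auto simp: indicator_def)
      fix \<omega>
      show "exp (\<eta> * (a n * X n \<omega>)) * indicator {\<omega>. z \<le> \<beta> * X n \<omega>} \<omega>
          \<le> exp (- (a n * z)) * exp ((\<eta> + \<beta>) * (a n * X n \<omega>))"
      proof (cases "z \<le> \<beta> * X n \<omega>")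
        case True
        then have "a n * z \<le> a n * (\<beta> * X n \<omega>)" using elim by simp
        then show ?thesis using True by (simp add: algebra_simps flip: exp_add)
      qed (simp add: less_imp_le)
    qed simp
    also have "\<dots> = exp (- (a n * z)) * mgf n (\<eta> + \<beta>)" by (simp add: mgf_def)
    also have "\<dots> \<le> exp (- (a n * z)) * exp (a n * (L (\<eta> + \<beta>) + e))"
      using elim by (intro mult_left_mono) auto
    also have "\<dots> = exp (a n * (L \<eta> - e)) * exp (- (a n * \<kappa>))"
      by (simp add: e_def field_simps flip: exp_add)
    also have "\<dots> \<le> mgf n \<eta> * exp (- (a n * \<kappa>))"
      using elim by (intro mult_right_mono) auto
    finally show ?case .
  qed
qed

text \<open>Each point of \<open>C\<close> has a slope \<beta> with
  \<open>c < \<beta> * x - L \<beta>\<close>. The corresponding open sets cover the compact set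
  \<open>C \<inter> {-1..1}\<close>, so finitely many Chernoff bounds suffice.\<close>

lemma upper_bound_closed:
  assumes "closed C" and above: "\<And>x. x \<in> C \<Longrightarrow> ereal c < legendre L x" and "d < c"
  shows "eventually (\<lambda>n. prob {\<omega> \<in> space M. X n \<omega> \<in> C} \<le> exp (a n * (- d))) F"
proof -
  define U where "U \<beta> = {y. c < \<beta> * y - L \<beta>}" for \<beta>
  have "compact (C \<inter> {-1..1})" using \<open>closed C\<close> by (simp add: closed_Int_compact)
  moreover have "C \<inter> {-1..1} \<subseteq> (\<Union>\<beta>\<in>UNIV. U \<beta>)"
    using above by (auto simp: less_legendre_iff U_def)
  moreover have "open (U \<beta>)" for \<beta>
    unfolding U_def by (intro open_Collect_less continuous_intros)
  ultimately obtain B where B: "finite B" "C \<inter> {-1..1} \<subseteq> (\<Union>\<beta>\<in>B. U \<beta>)"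
    by (meson compactE_image)
  \<comment> \<open>One half of the margin is given up in the Chernoff bounds, the other absorbs the
    number of sets in the cover.\<close>
  define e where "e = (c - d) / 2"
  have e: "e > 0" using \<open>d < c\<close> by (simp add: e_def)
  have "eventually (\<lambda>n. \<forall>\<beta>\<in>B. prob {\<omega> \<in> space M. X n \<omega> \<in> U \<beta>} \<le> exp (- (a n * (c - e)))) F"
    unfolding eventually_ball_finite_distrib[OF B(1)]
  proof
    fix \<beta>
    have "L (0 + \<beta>) - L 0 + (c - e) < L \<beta> + c" using e by (simp add: L_0)
    from chernoff_eventually[OF this]
    show "eventually (\<lambda>n. prob {\<omega> \<in> space M. X n \<omega> \<in> U \<beta>} \<le> exp (- (a n * (c - e)))) F"
    proof eventually_elim
      case (elim n)
      have "prob {\<omega> \<in> space M. X n \<omega> \<in> U \<beta>} \<le> prob ({\<omega>. L \<beta> + c \<le> \<beta> * X n \<omega>} \<inter> space M)"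
        by (intro finite_measure_mono) (auto simp: U_def)
      also have "\<dots> \<le> exp (- (a n * (c - e)))"
        using elim by simp
      finally show ?case .
    qed
  qed
  then show ?thesis
    using exp_speed_ge_eventually[OF e, of "real (card B)"]
  proof eventually_elim
    case (elim n)
    have "prob {\<omega> \<in> space M. X n \<omega> \<in> C} \<le> prob (\<Union>\<beta>\<in>B. {\<omega> \<in> space M. X n \<omega> \<in> U \<beta>})"
    proof (intro finite_measure_mono)
      have "X n \<omega> \<in> {-1..1}" if "\<omega> \<in> space M" for \<omega>
        using X_bounded[OF that, of n] by auto
      then show "{\<omega> \<in> space M. X n \<omega> \<in> C} \<subseteq> (\<Union>\<beta>\<in>B. {\<omega> \<in> space M. X n \<omega> \<in> U \<beta>})"
        using B(2) by blast
    qed (use B(1) in \<open>auto simp: U_def\<close>)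
    also have "\<dots> \<le> (\<Sum>\<beta>\<in>B. prob {\<omega> \<in> space M. X n \<omega> \<in> U \<beta>})"
      using B(1) by (intro finite_measure_subadditive_finite) (auto simp: U_def)
    also have "\<dots> \<le> (\<Sum>\<beta>\<in>B. exp (- (a n * (c - e))))"
      using elim by (intro sum_mono) auto
    also have "\<dots> = real (card B) * exp (- (a n * (c - e)))" by simp
    also have "\<dots> \<le> exp (a n * e) * exp (- (a n * (c - e)))"
      using elim by (intro mult_right_mono) auto
    also have "\<dots> = exp (a n * (- d))"
      by (simp add: e_def field_simps flip: exp_add)
    finally show ?case .
  qed
qed

text \<open>Under the measure tilted by \<open>exp (\<eta> * a n * X n)\<close> the variables \<open>X n\<close> concentrate at
  \<open>L' \<eta>\<close>: by differentiability a Chernoff bound with small parameter \<open>\<beta>\<close> beats any fixed deviation.\<close>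

lemma lower_bound_exposed:
  assumes "open G" "y \<in> G" and deriv: "(L has_real_derivative y) (at \<eta>)" and "\<eta> * y - L \<eta> < c"
  shows "eventually (\<lambda>n. exp (a n * (- c)) \<le> prob {\<omega> \<in> space M. X n \<omega> \<in> G}) F"
proof -
  \<comment> \<open>The margin is spent in three equal parts: on the variation of the tilt over the
    ball, on the lower bound for \<open>mgf n \<eta>\<close>, and on a factor 2.\<close>
  define e where "e = (c - (\<eta> * y - L \<eta>)) / 3"
  have e: "e > 0" using assms by (simp add: e_def)
  obtain \<delta>0 where \<delta>0: "\<delta>0 > 0" "ball y \<delta>0 \<subseteq> G"
    using assms(1,2) openE by blast
  \<comment> \<open>The summand 1 keeps the quotient defined when \<eta> is 0.\<close>
  define \<delta> where "\<delta> = min \<delta>0 (e / (\<bar>\<eta>\<bar> + 1))"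
  have \<delta>: "\<delta> > 0" "ball y \<delta> \<subseteq> G"
    using \<delta>0 e by (auto simp: \<delta>_def)
  have \<delta>e: "\<bar>\<eta>\<bar> * \<delta> \<le> e"
  proof -
    have "\<bar>\<eta>\<bar> * \<delta> \<le> (\<bar>\<eta>\<bar> + 1) * (e / (\<bar>\<eta>\<bar> + 1))"
      using \<delta>(1) by (intro mult_mono) (auto simp: \<delta>_def)
    then show ?thesis by simp
  qed
  obtain s where s: "s > 0" "\<And>h. h \<noteq> 0 \<Longrightarrow> \<bar>h\<bar> < s \<Longrightarrow> \<bar>(L (\<eta> + h) - L \<eta>) / h - y\<bar> < \<delta>"
    using LIM_D[OF DERIV_D[OF deriv] \<delta>(1)] by auto
  \<comment> \<open>The difference quotients at \<open>b\<close> and \<open>- b\<close> are within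
    \<delta> of \<open>y\<close>. Hence a further tilt by \<open>b\<close> or \<open>- b\<close>
    costs strictly less than it gains on a deviation by \<delta> to the right or left; \<kappa> is
    half of the smaller surplus.\<close>
  define b where "b = s / 2"
  have b: "b > 0" "\<bar>b\<bar> < s" "\<bar>- b\<bar> < s" using s(1) by (auto simp: b_def)
  have up: "L (\<eta> + b) - L \<eta> < b * (y + \<delta>)"
    using s(2)[of b] b by (simp add: abs_less_iff field_simps)
  have down: "L (\<eta> + (- b)) - L \<eta> < (- b) * (y - \<delta>)"
    using s(2)[of "- b"] b by (simp add: abs_less_iff field_simps)
  obtain \<kappa> where \<kappa>: "\<kappa> > 0" "L (\<eta> + b) - L \<eta> + \<kappa> < b * (y + \<delta>)"
      "L (\<eta> + (- b)) - L \<eta> + \<kappa> < (- b) * (y - \<delta>)"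
  proof
    let ?k = "min (b * (y + \<delta>) - (L (\<eta> + b) - L \<eta>)) ((- b) * (y - \<delta>) - (L (\<eta> + (- b)) - L \<eta>)) / 2"
    show "?k > 0" using up down by (simp add: min_def)
    show "L (\<eta> + b) - L \<eta> + ?k < b * (y + \<delta>)"
      using up down by (simp add: min_def field_simps)
    show "L (\<eta> + (- b)) - L \<eta> + ?k < (- b) * (y - \<delta>)"
      using up down by (simp add: min_def field_simps)
  qed
  have "L \<eta> - e < L \<eta>" using e by simp
  from chernoff_eventually[OF \<kappa>(2)] chernoff_eventually[OF \<kappa>(3)] mgf_ge_eventually[OF this]
    exp_speed_ge_eventually[OF \<kappa>(1), of 4] exp_speed_ge_eventually[OF e, of 2] speed_gt[of 0]
  show ?thesis
  proof eventually_elim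
    case (elim n)
    let ?w = "\<lambda>\<omega>. exp (\<eta> * (a n * X n \<omega>))"
    let ?U = "{\<omega>. b * (y + \<delta>) \<le> b * X n \<omega>}" and ?D = "{\<omega>. (- b) * (y - \<delta>) \<le> (- b) * X n \<omega>}"
      and ?B = "{\<omega>. X n \<omega> \<in> ball y \<delta>}"
    have int: "integrable M (\<lambda>\<omega>. ?w \<omega> * indicator ?U \<omega>)"
      "integrable M (\<lambda>\<omega>. ?w \<omega> * indicator ?D \<omega>)" "integrable M (\<lambda>\<omega>. ?w \<omega> * indicator ?B \<omega>)"
      by (intro integrable_exp_mult_bounded; simp add: indicator_def)+
    \<comment> \<open>The tilted mass splits into two tails and the ball around \<open>y\<close>.
      Each tail carries at most a quarter, so at least half stays in the ball.\<close>
    have "mgf n \<eta> \<le> (LINT \<omega>|M. ?w \<omega> * indicator ?U \<omega> + ?w \<omega> * indicator ?D \<omega> + ?w \<omega> * indicator ?B \<omega>)"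
      unfolding mgf_def
    proof (rule integral_mono)
      fix \<omega>
      have "\<omega> \<in> ?U \<or> \<omega> \<in> ?D \<or> \<omega> \<in> ?B"
        using b by (auto simp: dist_real_def)
      then show "?w \<omega> \<le> ?w \<omega> * indicator ?U \<omega> + ?w \<omega> * indicator ?D \<omega> + ?w \<omega> * indicator ?B \<omega>"
        by (auto simp: indicator_def simp del: mult_le_cancel_left_pos mult_le_cancel_left mem_ball)
    qed (use int in auto)
    also have "\<dots> = (LINT \<omega>|M. ?w \<omega> * indicator ?U \<omega>) + (LINT \<omega>|M. ?w \<omega> * indicator ?D \<omega>)
        + (LINT \<omega>|M. ?w \<omega> * indicator ?B \<omega>)"
      using int by simp
    also have "\<dots> \<le> mgf n \<eta> * exp (- (a n * \<kappa>)) + mgf n \<eta> * exp (- (a n * \<kappa>))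
        + (LINT \<omega>|M. ?w \<omega> * indicator ?B \<omega>)"
      using elim by (intro add_mono) auto
    also have "\<dots> \<le> mgf n \<eta> * (1/4) + mgf n \<eta> * (1/4) + (LINT \<omega>|M. ?w \<omega> * indicator ?B \<omega>)"
      using elim mgf_pos[of n \<eta>]
      by (intro add_mono mult_left_mono) (auto simp: exp_minus field_simps)
    finally have "mgf n \<eta> / 2 \<le> (LINT \<omega>|M. ?w \<omega> * indicator ?B \<omega>)" by simp
    \<comment> \<open>The tilt is undone: on the ball the weight is at most
      \<open>exp (a n * (\<eta> * y + e))\<close>.\<close>
    also have "\<dots> \<le> (LINT \<omega>|M. exp (a n * (\<eta> * y + e)) * indicator {\<omega> \<in> space M. X n \<omega> \<in> G} \<omega>)"
    proof (rule integral_mono[OF int(3)])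
      show "integrable M (\<lambda>\<omega>. exp (a n * (\<eta> * y + e)) * indicator {\<omega> \<in> space M. X n \<omega> \<in> G} \<omega>)"
        using events_X[of G n] \<open>open G\<close> by (intro integrable_mult_right integrable_real_indicator) (auto simp: emeasure_eq_measure)
      fix \<omega> assume \<omega>: "\<omega> \<in> space M"
      show "?w \<omega> * indicator ?B \<omega> \<le> exp (a n * (\<eta> * y + e)) * indicator {\<omega> \<in> space M. X n \<omega> \<in> G} \<omega>"
      proof (cases "\<omega> \<in> ?B")
        case True
        then have G: "X n \<omega> \<in> G" using \<delta>(2) by auto
        have "\<eta> * (X n \<omega> - y) \<le> \<bar>\<eta>\<bar> * \<bar>X n \<omega> - y\<bar>" by (metis abs_ge_self abs_mult)
        also have "\<dots> \<le> \<bar>\<eta>\<bar> * \<delta>"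
          using True by (intro mult_left_mono) (auto simp: dist_real_def)
        finally have "\<eta> * X n \<omega> \<le> \<eta> * y + e" using \<delta>e by (simp add: algebra_simps)
        then have "a n * (\<eta> * X n \<omega>) \<le> a n * (\<eta> * y + e)"
          using elim by (intro mult_left_mono) auto
        then show ?thesis using G \<omega> True by (simp add: algebra_simps)
      qed (simp add: indicator_def)
    qed
    also have "\<dots> = exp (a n * (\<eta> * y + e)) * prob {\<omega> \<in> space M. X n \<omega> \<in> G}"
      by (simp add: Int_def conj_commute)
    finally have *: "mgf n \<eta> / 2 \<le> exp (a n * (\<eta> * y + e)) * prob {\<omega> \<in> space M. X n \<omega> \<in> G}" .
    have "exp (a n * (\<eta> * y + e)) * (2 * exp (a n * (- c)))
        \<le> exp (a n * (\<eta> * y + e)) * (exp (a n * e) * exp (a n * (- c)))"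
      using elim by (intro mult_left_mono mult_right_mono) auto
    also have "\<dots> = exp (a n * (L \<eta> - e))"
      by (simp add: e_def field_simps flip: exp_add)
    also have "\<dots> \<le> mgf n \<eta>" using elim by simp
    also have "\<dots> \<le> 2 * (exp (a n * (\<eta> * y + e)) * prob {\<omega> \<in> space M. X n \<omega> \<in> G})"
      using * by simp
    finally show ?case by simp
  qed
qed

text \<open>A point strictly between two points of finite rate is exposed: there \<open>\<beta> y - L \<beta>\<close> tends to
  \<open>-\<infinity>\<close> in both directions, hence attains its maximum.\<close>

lemma exposed_between:
  assumes "legendre L x \<le> ereal c" "legendre L z \<le> ereal c" "x \<noteq> z" "0 < t" "t < 1"
  shows "\<exists>\<eta>. (L has_real_derivative ((1 - t) * x + t * z)) (at \<eta>)"
proof -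
  define y where "y = (1 - t) * x + t * z"
  define g where "g \<beta> = \<beta> * y - L \<beta>" for \<beta>
  \<comment> \<open>This is the distance from \<open>y\<close> to the nearer of \<open>x\<close> and
    \<open>z\<close>. The bound at \<open>x\<close> or at \<open>z\<close>, chosen by the sign of
    \<open>\<beta> * (x - z)\<close>, makes \<open>g\<close> decay at this slope.\<close>
  define \<kappa> where "\<kappa> = min t (1 - t) * \<bar>x - z\<bar>"
  have \<kappa>: "\<kappa> > 0" using assms by (simp add: \<kappa>_def)
  have coercive: "g \<beta> \<le> c - \<kappa> * \<bar>\<beta>\<bar>" for \<beta>
  proof (cases "\<beta> * (x - z) \<ge> 0")
    case True
    have "\<kappa> * \<bar>\<beta>\<bar> = min t (1 - t) * (\<beta> * (x - z))"
      using True by (simp add: \<kappa>_def abs_mult[symmetric] mult.commute mult.left_commute)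
    also have "\<dots> \<le> t * (\<beta> * (x - z))" using True by (intro mult_right_mono) auto
    finally have "g \<beta> \<le> \<beta> * x - L \<beta> - \<kappa> * \<bar>\<beta>\<bar>" by (simp add: g_def y_def algebra_simps)
    then show ?thesis using assms(1)[unfolded legendre_le_iff, rule_format, of \<beta>] by linarith
  next
    case False
    have "\<kappa> * \<bar>\<beta>\<bar> = min t (1 - t) * \<bar>\<beta> * (x - z)\<bar>" by (simp add: \<kappa>_def abs_mult)
    also have "\<bar>\<beta> * (x - z)\<bar> = \<beta> * (z - x)" using False by (simp add: algebra_simps)
    also have "min t (1 - t) * (\<beta> * (z - x)) \<le> (1 - t) * (\<beta> * (z - x))"
      using False by (intro mult_right_mono) (auto simp: algebra_simps)
    finally have "g \<beta> \<le> \<beta> * z - L \<beta> - \<kappa> * \<bar>\<beta>\<bar>" by (simp add: g_def y_def algebra_simps)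
    then show ?thesis using assms(2)[unfolded legendre_le_iff, rule_format, of \<beta>] by linarith
  qed
  \<comment> \<open>Beyond \<open>\<bar>c\<bar> / \<kappa>\<close> the decay forces \<open>g\<close>
    below \<open>g 0 = 0\<close>, so a maximum over this interval is global.\<close>
  define R where "R = \<bar>c\<bar> / \<kappa> + 1"
  have R0: "0 \<le> R" using \<kappa> by (simp add: R_def)
  have "continuous_on {-R..R} g"
    unfolding g_def by (intro continuous_intros continuous_at_imp_continuous_on ballI
        differentiable_imp_continuous_within L_differentiable)
  then obtain \<eta> where \<eta>: "\<eta> \<in> {-R..R}" "\<And>\<beta>. \<beta> \<in> {-R..R} \<Longrightarrow> g \<beta> \<le> g \<eta>"
    using continuous_attains_sup[of "{-R..R}" g] R0 by auto
  have max: "g \<beta> \<le> g \<eta>" for \<beta>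
  proof (cases "\<beta> \<in> {-R..R}")
    case False
    have "0 \<in> {-R..R}" using R0 by simp
    then have "g \<eta> \<ge> 0" using \<eta>(2)[of 0] by (simp add: g_def L_0)
    moreover have "R < \<bar>\<beta>\<bar>" using False by auto
    then have "\<bar>c\<bar> / \<kappa> < \<bar>\<beta>\<bar>" by (simp add: R_def)
    then have "c < \<bar>\<beta>\<bar> * \<kappa>" using \<kappa> by (simp add: pos_divide_less_eq)
    then have "c \<le> \<kappa> * \<bar>\<beta>\<bar>" by (simp add: mult.commute)
    ultimately show ?thesis using coercive[of \<beta>] by linarith
  qed (use \<eta> in auto)
  obtain D where D: "(L has_real_derivative D) (at \<eta>)"
    using L_differentiable[of \<eta>] real_differentiable_def by blast
  have "(g has_real_derivative (y - D)) (at \<eta>)"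
    unfolding g_def by (auto intro!: derivative_eq_intros D)
  then have "y - D = 0"
    by (rule DERIV_local_max[where d = 1]) (auto simp: max)
  then show ?thesis using D by (auto simp: y_def)
qed

text \<open>The point \<open>z = L' 0\<close> has rate 0. Moving \<open>x\<close> slightly towards
  \<open>z\<close> stays inside \<open>G\<close>, keeps the rate at most \<open>c\<close> by
  convexity, and reaches an exposed point.\<close>

lemma lower_bound_open:
  assumes "open G" "x \<in> G" and fin: "legendre L x \<le> ereal c" and "c < d"
  shows "eventually (\<lambda>n. exp (a n * (- d)) \<le> prob {\<omega> \<in> space M. X n \<omega> \<in> G}) F"
proof -
  have c0: "0 \<le> c"
    using order.trans[OF legendre_nonneg fin] by simp
  obtain z where z: "(L has_real_derivative z) (at 0)"
    using L_differentiable[of 0] real_differentiable_def by blast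
  have Iz: "legendre L z = 0" using legendre_at_derivative[OF z] by (simp add: L_0 zero_ereal_def)
  show ?thesis
  proof (cases "x = z")
    case True
    then show ?thesis using assms c0 z
      by (intro lower_bound_exposed[of G z 0]) (auto simp: L_0)
  next
    case False
    have "((\<lambda>t. (1 - t) * x + t * z) \<longlongrightarrow> (1 - 0) * x + 0 * z) (at_right 0)"
      by (intro tendsto_intros)
    then have "eventually (\<lambda>t. (1 - t) * x + t * z \<in> G) (at_right 0)"
      using assms by (intro topological_tendstoD) auto
    moreover have "eventually (\<lambda>t. 0 < t \<and> t < (1::real)) (at_right 0)"
      by (rule eventually_at_rightI[of 0 1]) auto
    ultimately have "eventually (\<lambda>t. (1 - t) * x + t * z \<in> G \<and> 0 < t \<and> t < 1) (at_right 0)"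
      by eventually_elim auto
    then obtain t where t: "(1 - t) * x + t * z \<in> G" "0 < t" "t < 1"
      using eventually_happens'[OF trivial_limit_at_right_real] by blast
    have Iz': "legendre L z \<le> ereal c" using Iz c0 by simp
    obtain \<eta> where \<eta>: "(L has_real_derivative ((1 - t) * x + t * z)) (at \<eta>)"
      using exposed_between[OF fin Iz' False t(2,3)] by blast
    have "legendre L ((1 - t) * x + t * z) \<le> ereal ((1 - t) * c + t * c)"
      using t by (intro legendre_convex fin Iz') auto
    then have "\<eta> * ((1 - t) * x + t * z) - L \<eta> \<le> c"
      by (simp add: legendre_le_iff algebra_simps)
    then show ?thesis
      using assms t \<eta> by (intro lower_bound_exposed) auto
  qed
qed

section \<open>The large deviation principle\<close>

text \<open>Testing against strict upper bounds \<open>w\<close> leaves two real numbers below the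
  infimum, so an infinite infimum is treated in the same way as a finite one.\<close>

lemma Limsup_le:
  assumes "A \<in> sets borel"
  shows "Limsup F (\<lambda>n. log_ext (prob {\<omega> \<in> space M. X n \<omega> \<in> A}) / ereal (a n))
           \<le> - (INF x\<in>closure A. legendre L x)"
proof (rule dense_ge)
  fix w assume "- (INF x\<in>closure A. legendre L x) < w"
  then have "- w < (INF x\<in>closure A. legendre L x)" using ereal_uminus_less_reorder by blast
  then obtain d where d: "- w < ereal d" "ereal d < (INF x\<in>closure A. legendre L x)"
    using ereal_dense2 by blast
  then obtain c where c: "ereal d < ereal c" "ereal c < (INF x\<in>closure A. legendre L x)"
    using ereal_dense2 by blast
  have "ereal c < legendre L x" if "x \<in> closure A" for x
    using c(2) that by (meson INF_lower less_le_trans)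
  then have "eventually (\<lambda>n. prob {\<omega> \<in> space M. X n \<omega> \<in> closure A} \<le> exp (a n * (- d))) F"
    using c(1) by (intro upper_bound_closed) auto
  then have "eventually (\<lambda>n. log_ext (prob {\<omega> \<in> space M. X n \<omega> \<in> A}) / ereal (a n) \<le> ereal (- d)) F"
    using speed_gt[of 0]
  proof eventually_elim
    case (elim n)
    have "prob {\<omega> \<in> space M. X n \<omega> \<in> A} \<le> prob {\<omega> \<in> space M. X n \<omega> \<in> closure A}"
      using closure_subset by (intro finite_measure_mono events_X) auto
    then show ?case using elim by (subst log_ext_div_le_iff) auto
  qed
  then have "Limsup F (\<lambda>n. log_ext (prob {\<omega> \<in> space M. X n \<omega> \<in> A}) / ereal (a n)) \<le> ereal (- d)"
    by (rule Limsup_bounded)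
  also have "ereal (- d) \<le> w" using d(1)
    by (metis ereal_uminus_less_reorder less_imp_le uminus_ereal.simps(1))
  finally show "Limsup F (\<lambda>n. log_ext (prob {\<omega> \<in> space M. X n \<omega> \<in> A}) / ereal (a n)) \<le> w" .
qed

lemma Liminf_ge:
  assumes "A \<in> sets borel"
  shows "- (INF x\<in>interior A. legendre L x)
           \<le> Liminf F (\<lambda>n. log_ext (prob {\<omega> \<in> space M. X n \<omega> \<in> A}) / ereal (a n))"
proof (rule dense_le)
  fix w assume "w < - (INF x\<in>interior A. legendre L x)"
  then have "(INF x\<in>interior A. legendre L x) < - w" using ereal_less_uminus_reorder by blast
  then obtain x where x: "x \<in> interior A" "legendre L x < - w" by (auto simp: INF_less_iff)
  then obtain c where c: "legendre L x < ereal c" "ereal c < - w"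
    using ereal_dense2 by blast
  then obtain d where d: "ereal c < ereal d" "ereal d < - w"
    using ereal_dense2 by blast
  have "eventually (\<lambda>n. exp (a n * (- d)) \<le> prob {\<omega> \<in> space M. X n \<omega> \<in> interior A}) F"
    using x c d by (intro lower_bound_open[of _ x c]) auto
  then have "eventually (\<lambda>n. ereal (- d) \<le> log_ext (prob {\<omega> \<in> space M. X n \<omega> \<in> A}) / ereal (a n)) F"
    using speed_gt[of 0]
  proof eventually_elim
    case (elim n)
    have "prob {\<omega> \<in> space M. X n \<omega> \<in> interior A} \<le> prob {\<omega> \<in> space M. X n \<omega> \<in> A}"
      using interior_subset assms by (intro finite_measure_mono events_X) auto
    then show ?case using elim by (subst le_log_ext_div_iff) auto
  qed
  then have "ereal (- d) \<le> Liminf F (\<lambda>n. log_ext (prob {\<omega> \<in> space M. X n \<omega> \<in> A}) / ereal (a n))"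
    by (rule Liminf_bounded)
  moreover have "w \<le> ereal (- d)" using d(2)
    by (metis ereal_less_uminus_reorder less_imp_le uminus_ereal.simps(1))
  ultimately show "w \<le> Liminf F (\<lambda>n. log_ext (prob {\<omega> \<in> space M. X n \<omega> \<in> A}) / ereal (a n))"
    by (rule order.trans[rotated])
qed

theorem ldp: "large_deviation_principle F a M X (legendre L)"
  unfolding large_deviation_principle_def
  using legendre_nonneg closed_legendre_sublevel Limsup_le Liminf_ge by auto

section \<open>Rates of shrinking windows\<close>

text \<open>A point of the closed window is pushed slightly towards the interior point
  \<open>w\<close> of finite rate. It lands in the open window, and by convexity its rate rises by
  an arbitrarily small amount.\<close>

lemma INF_cball_eq_INF_ball:
  assumes "legendre L w < \<infinity>" "\<bar>w - x\<bar> < \<epsilon>"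
  shows "(INF y\<in>{x - \<epsilon>..x + \<epsilon>}. legendre L y) = (INF y\<in>{x - \<epsilon><..<x + \<epsilon>}. legendre L y)"
proof (rule antisym)
  show "(INF y\<in>{x - \<epsilon>..x + \<epsilon>}. legendre L y) \<le> (INF y\<in>{x - \<epsilon><..<x + \<epsilon>}. legendre L y)"
    by (intro INF_superset_mono) auto
  show "(INF y\<in>{x - \<epsilon><..<x + \<epsilon>}. legendre L y) \<le> (INF y\<in>{x - \<epsilon>..x + \<epsilon>}. legendre L y)"
  proof (rule INF_greatest, rule dense_ge)
    fix z u assume z: "z \<in> {x - \<epsilon>..x + \<epsilon>}" and "legendre L z < u"
    then obtain c where c: "legendre L z < ereal c" "ereal c < u" using ereal_dense2 by blast
    then obtain c' where c': "ereal c < ereal c'" "ereal c' < u" using ereal_dense2 by blast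
    obtain d where d: "legendre L w < ereal d" using assms(1) ereal_dense2 by blast
    have "((\<lambda>t. (1 - t) * c + t * d) \<longlongrightarrow> (1 - 0) * c + 0 * d) (at_right 0)"
      by (intro tendsto_intros)
    then have "eventually (\<lambda>t. (1 - t) * c + t * d < c') (at_right 0)"
      using c' by (intro order_tendstoD) auto
    moreover have "eventually (\<lambda>t. 0 < t \<and> t < (1::real)) (at_right 0)"
      by (rule eventually_at_rightI[of 0 1]) auto
    ultimately have "eventually (\<lambda>t. (1 - t) * c + t * d < c' \<and> 0 < t \<and> t < 1) (at_right 0)"
      by eventually_elim auto
    then obtain t where t: "(1 - t) * c + t * d < c'" "0 < t" "t < 1"
      using eventually_happens'[OF trivial_limit_at_right_real] by blast
    let ?y = "(1 - t) * z + t * w"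
    have "\<bar>?y - x\<bar> = \<bar>(1 - t) * (z - x) + t * (w - x)\<bar>" by (simp add: algebra_simps)
    also have "\<dots> \<le> (1 - t) * \<bar>z - x\<bar> + t * \<bar>w - x\<bar>"
      using t by (intro order.trans[OF abs_triangle_ineq]) (simp add: abs_mult)
    also have "\<dots> < (1 - t) * \<epsilon> + t * \<epsilon>"
      using t z assms(2) by (intro add_le_less_mono mult_left_mono mult_strict_left_mono) auto
    finally have "\<bar>?y - x\<bar> < \<epsilon>" by (simp add: algebra_simps)
    then have "(INF y\<in>{x - \<epsilon><..<x + \<epsilon>}. legendre L y) \<le> legendre L ?y"
      by (intro INF_lower) auto
    also have "\<dots> \<le> ereal ((1 - t) * c + t * d)"
      using c d t by (intro legendre_convex) auto
    also have "\<dots> \<le> ereal c'" using t by simp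
    also have "\<dots> \<le> u" using c' by simp
    finally show "(INF y\<in>{x - \<epsilon><..<x + \<epsilon>}. legendre L y) \<le> u" .
  qed
qed

text \<open>The disjunction rules out that finite rates occur in the window only at an endpoint.
  Otherwise open and closed windows have equal infima, and the two large deviation bounds
  meet.\<close>

lemma window_limit:
  assumes "0 < \<epsilon>" "(\<exists>w. legendre L w < \<infinity> \<and> \<bar>w - x\<bar> < \<epsilon>) \<or> (\<forall>w\<in>{x - \<epsilon>..x + \<epsilon>}. legendre L w = \<infinity>)"
  shows "((\<lambda>n. - log_ext (prob {\<omega> \<in> space M. X n \<omega> \<in> {x - \<epsilon>..x + \<epsilon>}}) / ereal (a n))
           \<longlongrightarrow> (INF y\<in>{x - \<epsilon>..x + \<epsilon>}. legendre L y)) F"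
proof -
  let ?A = "{x - \<epsilon>..x + \<epsilon>}"
  let ?f = "\<lambda>n. log_ext (prob {\<omega> \<in> space M. X n \<omega> \<in> ?A}) / ereal (a n)"
  have eq: "(INF y\<in>?A. legendre L y) = (INF y\<in>{x - \<epsilon><..<x + \<epsilon>}. legendre L y)"
    using assms(2)
  proof
    assume inf: "\<forall>w\<in>?A. legendre L w = \<infinity>"
    have "(INF y\<in>?A. legendre L y) = (INF y\<in>?A. \<infinity>)"
      by (rule INF_cong) (use inf in auto)
    moreover have "(INF y\<in>{x - \<epsilon><..<x + \<epsilon>}. legendre L y) = (INF y\<in>{x - \<epsilon><..<x + \<epsilon>}. \<infinity>)"
      by (rule INF_cong) (use inf in auto)
    ultimately show ?thesis using \<open>0 < \<epsilon>\<close> by simp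
  qed (use INF_cball_eq_INF_ball in blast)
  have "Limsup F ?f \<le> - (INF y\<in>?A. legendre L y)"
    using Limsup_le[of ?A] by simp
  moreover have "- (INF y\<in>?A. legendre L y) \<le> Liminf F ?f"
    using Liminf_ge[of ?A] eq by (simp add: interior_atLeastAtMost_real)
  ultimately have "(?f \<longlongrightarrow> - (INF y\<in>?A. legendre L y)) F"
    using Liminf_le_Limsup[OF F_nontrivial, of ?f]
    by (intro tendsto_Limsup[THEN tendsto_eq_rhs] F_nontrivial) (auto intro: antisym order.trans)
  then have "((\<lambda>n. - ?f n) \<longlongrightarrow> - (- (INF y\<in>?A. legendre L y))) F"
    by (intro tendsto_intros)
  then show ?thesis by (simp add: divide_ereal_def ereal_mult_minus_left)
qed

text \<open>Either every neighbourhood of \<open>x\<close> contains a point of finite rate, or some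
  neighbourhood contains none; smaller windows inherit the same alternative.\<close>

lemma eventually_window_limit:
  "eventually (\<lambda>\<epsilon>. ((\<lambda>n. - log_ext (prob {\<omega> \<in> space M. X n \<omega> \<in> {x - \<epsilon>..x + \<epsilon>}}) / ereal (a n))
     \<longlongrightarrow> (INF y\<in>{x - \<epsilon>..x + \<epsilon>}. legendre L y)) F) (at_right 0)"
proof (cases "\<forall>\<epsilon>>0. \<exists>w. legendre L w < \<infinity> \<and> \<bar>w - x\<bar> < \<epsilon>")
  case True
  then show ?thesis by (intro eventually_at_rightI[of 0 1] window_limit) auto
next
  case False
  then obtain \<epsilon>0 where "\<epsilon>0 > 0" "\<And>w. \<bar>w - x\<bar> < \<epsilon>0 \<Longrightarrow> legendre L w = \<infinity>" by force
  then show ?thesis by (intro eventually_at_rightI[of 0 \<epsilon>0] window_limit) auto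
qed

text \<open>Lower semicontinuity controls the infimum from below; from above it is bounded by the
  value at \<open>x\<close>, which lies in every window.\<close>

lemma INF_window_tendsto:
  "((\<lambda>\<epsilon>. INF y\<in>{x - \<epsilon>..x + \<epsilon>}. legendre L y) \<longlongrightarrow> legendre L x) (at_right 0)"
proof (rule order_tendstoI)
  fix u assume "u < legendre L x"
  then obtain c where c: "u < ereal c" "ereal c < legendre L x" using ereal_dense2 by blast
  have "open (- {y. legendre L y \<le> ereal c})"
    using closed_legendre_sublevel by blast
  moreover have "x \<in> - {y. legendre L y \<le> ereal c}" using c by auto
  ultimately obtain \<delta> where \<delta>: "\<delta> > 0" "ball x \<delta> \<subseteq> - {y. legendre L y \<le> ereal c}"
    using openE by blast
  have "u < (INF y\<in>{x - \<epsilon>..x + \<epsilon>}. legendre L y)" if "\<epsilon> < \<delta>" for \<epsilon>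
  proof -
    have "{x - \<epsilon>..x + \<epsilon>} \<subseteq> ball x \<delta>" using that by (auto simp: dist_real_def)
    then have "\<not> legendre L y \<le> ereal c" if "y \<in> {x - \<epsilon>..x + \<epsilon>}" for y
      using \<delta>(2) that by blast
    then have "ereal c \<le> (INF y\<in>{x - \<epsilon>..x + \<epsilon>}. legendre L y)"
      by (intro INF_greatest) (use linear in blast)
    then show ?thesis using c(1) by simp
  qed
  then show "eventually (\<lambda>\<epsilon>. u < (INF y\<in>{x - \<epsilon>..x + \<epsilon>}. legendre L y)) (at_right 0)"
    using \<delta>(1) by (intro eventually_at_rightI[of 0 \<delta>]) auto
next
  fix u assume u: "legendre L x < u"
  have "(INF y\<in>{x - \<epsilon>..x + \<epsilon>}. legendre L y) < u" if "0 < \<epsilon>" for \<epsilon>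
    using that INF_lower[of x "{x - \<epsilon>..x + \<epsilon>}" "legendre L"] u by auto
  then show "eventually (\<lambda>\<epsilon>. (INF y\<in>{x - \<epsilon>..x + \<epsilon>}. legendre L y) < u) (at_right 0)"
    by (intro eventually_at_rightI[of 0 1]) auto
qed

end

section \<open>Partition functions of open chains\<close>

lemma space_spin_measure [simp]: "space (spin_measure r) = {1, -1}"
  by (simp add: spin_measure_def space_point_measure)

lemma measurable_spin_measure [measurable]: "f \<in> borel_measurable (spin_measure r)"
  by (simp add: spin_measure_def)

lemma measurable_spin_compose:
  assumes "i \<in> I"
  shows "(\<lambda>\<sigma>. f (\<sigma> i)) \<in> borel_measurable (PiM I (\<lambda>_. spin_measure r))"
  using measurable_compose[OF measurable_component_singleton[OF assms, of "\<lambda>_. spin_measure r"]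
      measurable_spin_measure[of f r]] .

lemmas measurable_spin_coordinate = measurable_spin_compose[where f = "\<lambda>x. x"]

lemma integral_spin_measure:
  fixes g :: "real \<Rightarrow> real"
  assumes "0 < r" "r < 1"
  shows "(LINT s|spin_measure r. g s) = r * g 1 + (1 - r) * g (-1)"
proof -
  have "spin_measure r = density (count_space {1, -1}) (\<lambda>s. ennreal (if s = 1 then r else 1 - r))"
    by (simp add: spin_measure_def point_measure_def)
  then have "(LINT s|spin_measure r. g s)
      = (LINT s|count_space {1, -1}. (if s = 1 then r else 1 - r) *\<^sub>R g s)"
    using assms by (simp only:) (subst integral_density, auto simp: AE_count_space)
  also have "\<dots> = r * g 1 + (1 - r) * g (-1)"
    by (subst lebesgue_integral_count_space_finite) auto
  finally show ?thesis .
qed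

lemma prob_space_spin_measure:
  assumes "0 < r" "r < 1"
  shows "prob_space (spin_measure r)"
proof
  show "emeasure (spin_measure r) (space (spin_measure r)) = 1"
    using assms unfolding space_spin_measure
    by (simp add: spin_measure_def emeasure_point_measure_finite flip: ennreal_plus)
qed

text \<open>\<open>chain_weight r \<beta> l s\<close> integrates out the remaining \<open>l\<close> spins of an open chain whose end spin is \<open>s\<close>;
  \<open>chain_Z r \<beta> l\<close> also averages over the end spin, so it has \<open>l\<close> bonds but \<open>l + 1\<close> spins.\<close>

fun chain_weight :: "real \<Rightarrow> real \<Rightarrow> nat \<Rightarrow> real \<Rightarrow> real" where
  "chain_weight r \<beta> 0 s = 1"
| "chain_weight r \<beta> (Suc l) s =
     r * exp (\<beta> * s) * chain_weight r \<beta> l 1 + (1 - r) * exp (- (\<beta> * s)) * chain_weight r \<beta> l (-1)"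

definition chain_Z :: "real \<Rightarrow> real \<Rightarrow> nat \<Rightarrow> real" where
  "chain_Z r \<beta> l = r * chain_weight r \<beta> l 1 + (1 - r) * chain_weight r \<beta> l (-1)"

locale spin_bias =
  fixes r :: real
  assumes r_pos: "0 < r" and r_less_1: "r < 1"
begin

sublocale spin: prob_space "spin_measure r"
  using r_pos r_less_1 by (rule prob_space_spin_measure)

lemma prob_space_spins: "prob_space (PiM I (\<lambda>_. spin_measure r))"
  by (intro prob_space_PiM spin.prob_space_axioms)

text \<open>Finitely many spins have finitely many configurations, so every function of them is
  bounded.\<close>

lemma integrable_finite_spins:
  fixes f :: "('i \<Rightarrow> real) \<Rightarrow> real"
  assumes "finite I" "f \<in> borel_measurable (PiM I (\<lambda>_. spin_measure r))"
  shows "integrable (PiM I (\<lambda>_. spin_measure r)) f"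
proof -
  have fin: "finite (space (PiM I (\<lambda>_. spin_measure r)))"
    using \<open>finite I\<close> by (auto simp: space_PiM intro!: finite_PiE)
  let ?B = "\<Sum>x\<in>space (PiM I (\<lambda>_. spin_measure r)). \<bar>f x\<bar>"
  have "AE x in PiM I (\<lambda>_. spin_measure r). norm (f x) \<le> ?B"
  proof (rule AE_I2)
    fix x assume "x \<in> space (PiM I (\<lambda>_. spin_measure r))"
    then show "norm (f x) \<le> ?B"
      using member_le_sum[OF _ _ fin, of x "\<lambda>x. \<bar>f x\<bar>"] by simp
  qed
  then show ?thesis
    by (rule finite_measure.integrable_const_bound[OF prob_space.finite_measure[OF prob_space_spins] _ assms(2)])
qed

section \<open>Growth and differentiability in \<beta>\<close>

lemma chain_weight_pos: "0 < chain_weight r \<beta> l s"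
  by (induction l arbitrary: s) (simp_all add: r_pos r_less_1 add_pos_pos)

lemma chain_Z_pos: "0 < chain_Z r \<beta> l"
  unfolding chain_Z_def by (intro add_pos_pos mult_pos_pos chain_weight_pos) (auto simp: r_pos r_less_1)

text \<open>Differentiating once brings down a sum of \<open>l\<close> bond energies, each of
  modulus at most 1. The recursion carries this bound without writing the weight as an
  expectation.\<close>

lemma chain_weight_deriv:
  assumes "\<bar>s\<bar> \<le> 1"
  shows "\<exists>D. ((\<lambda>\<beta>. chain_weight r \<beta> l s) has_real_derivative D) (at \<beta>) \<and>
           \<bar>D\<bar> \<le> real l * chain_weight r \<beta> l s"
  using assms
proof (induction l arbitrary: s)
  case 0
  then show ?case by (auto intro!: exI[of _ 0])
next
  case (Suc l)
  obtain D where D: "((\<lambda>\<beta>. chain_weight r \<beta> l 1) has_real_derivative D) (at \<beta>)"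
      "\<bar>D\<bar> \<le> real l * chain_weight r \<beta> l 1"
    using Suc.IH[of 1] by auto
  obtain D' where D': "((\<lambda>\<beta>. chain_weight r \<beta> l (-1)) has_real_derivative D') (at \<beta>)"
      "\<bar>D'\<bar> \<le> real l * chain_weight r \<beta> l (-1)"
    using Suc.IH[of "-1"] by auto
  let ?u = "chain_weight r \<beta> l 1" and ?v = "chain_weight r \<beta> l (-1)"
  let ?E = "r * exp (\<beta> * s) * (s * ?u + D) + (1 - r) * exp (- (\<beta> * s)) * (- s * ?v + D')"
  have "((\<lambda>\<beta>. chain_weight r \<beta> (Suc l) s) has_real_derivative ?E) (at \<beta>)"
    unfolding chain_weight.simps
    by (rule derivative_eq_intros D D' refl)+ (simp add: algebra_simps)
  moreover have "\<bar>?E\<bar> \<le> real (Suc l) * chain_weight r \<beta> (Suc l) s"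
  proof -
    have "\<bar>s * ?u + D\<bar> \<le> \<bar>s\<bar> * ?u + \<bar>D\<bar>" "\<bar>- s * ?v + D'\<bar> \<le> \<bar>s\<bar> * ?v + \<bar>D'\<bar>"
      using chain_weight_pos[of \<beta> l 1] chain_weight_pos[of \<beta> l "-1"]
      by (auto intro!: order.trans[OF abs_triangle_ineq] simp: abs_mult)
        (metis abs_minus_commute abs_mult abs_of_pos abs_triangle_ineq4)
    moreover have "\<bar>s\<bar> * ?u \<le> 1 * ?u" "\<bar>s\<bar> * ?v \<le> 1 * ?v"
      using Suc.prems chain_weight_pos by (auto intro!: mult_right_mono less_imp_le)
    ultimately have b: "\<bar>s * ?u + D\<bar> \<le> real (Suc l) * ?u" "\<bar>- s * ?v + D'\<bar> \<le> real (Suc l) * ?v"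
      using D(2) D'(2) by (auto simp: algebra_simps)
    have "\<bar>?E\<bar> \<le> \<bar>r * exp (\<beta> * s) * (s * ?u + D)\<bar> + \<bar>(1 - r) * exp (- (\<beta> * s)) * (- s * ?v + D')\<bar>"
      by (rule abs_triangle_ineq)
    also have "\<dots> = r * exp (\<beta> * s) * \<bar>s * ?u + D\<bar> + (1 - r) * exp (- (\<beta> * s)) * \<bar>- s * ?v + D'\<bar>"
      using r_pos r_less_1 by (simp add: abs_mult)
    also have "\<dots> \<le> r * exp (\<beta> * s) * (real (Suc l) * ?u) + (1 - r) * exp (- (\<beta> * s)) * (real (Suc l) * ?v)"
      using r_pos r_less_1 b by (intro add_mono mult_left_mono) auto
    also have "\<dots> = real (Suc l) * chain_weight r \<beta> (Suc l) s"
      by (simp add: algebra_simps)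
    finally show ?thesis .
  qed
  ultimately show ?case by blast
qed

text \<open>The bound does not depend on \<beta>; this uniformity later permits termwise
  differentiation.\<close>

lemma ln_chain_Z_deriv:
  "\<exists>D. ((\<lambda>\<beta>. ln (chain_Z r \<beta> l)) has_real_derivative D) (at \<beta>) \<and> \<bar>D\<bar> \<le> real l"
proof -
  obtain D where D: "((\<lambda>\<beta>. chain_weight r \<beta> l 1) has_real_derivative D) (at \<beta>)"
      "\<bar>D\<bar> \<le> real l * chain_weight r \<beta> l 1"
    using chain_weight_deriv[of 1] by auto
  obtain D' where D': "((\<lambda>\<beta>. chain_weight r \<beta> l (-1)) has_real_derivative D') (at \<beta>)"
      "\<bar>D'\<bar> \<le> real l * chain_weight r \<beta> l (-1)"
    using chain_weight_deriv[of "-1"] by auto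
  let ?E = "r * D + (1 - r) * D'"
  have "((\<lambda>\<beta>. chain_Z r \<beta> l) has_real_derivative ?E) (at \<beta>)"
    unfolding chain_Z_def by (rule derivative_eq_intros D D' refl)+ simp
  then have "((\<lambda>\<beta>. ln (chain_Z r \<beta> l)) has_real_derivative (?E / chain_Z r \<beta> l)) (at \<beta>)"
    using chain_Z_pos by (auto intro!: derivative_eq_intros simp: field_simps)
  moreover have "\<bar>?E\<bar> \<le> real l * chain_Z r \<beta> l"
  proof -
    have "\<bar>?E\<bar> \<le> \<bar>r * D\<bar> + \<bar>(1 - r) * D'\<bar>" by (rule abs_triangle_ineq)
    also have "\<dots> = r * \<bar>D\<bar> + (1 - r) * \<bar>D'\<bar>" using r_pos r_less_1 by (simp add: abs_mult)
    also have "\<dots> \<le> r * (real l * chain_weight r \<beta> l 1) + (1 - r) * (real l * chain_weight r \<beta> l (-1))"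
      using r_pos r_less_1 D D' by (intro add_mono mult_left_mono) auto
    finally show ?thesis by (simp add: chain_Z_def algebra_simps)
  qed
  then have "\<bar>?E / chain_Z r \<beta> l\<bar> \<le> real l"
    using chain_Z_pos[of \<beta> l] by (simp add: field_simps)
  ultimately show ?thesis by blast
qed

lemma chain_Z_0 [simp]: "chain_Z r 0 l = 1"
proof -
  have "chain_weight r 0 l s = 1" for s by (induction l arbitrary: s) auto
  then show ?thesis by (simp add: chain_Z_def)
qed

text \<open>The logarithm vanishes at \<open>\<beta> = 0\<close>, and its derivative is bounded by
  \<open>l\<close>.\<close>

lemma ln_chain_Z_bound: "\<bar>ln (chain_Z r \<beta> l)\<bar> \<le> real l * \<bar>\<beta>\<bar>"
proof -
  obtain f' where f': "\<And>\<beta>. ((\<lambda>\<beta>. ln (chain_Z r \<beta> l)) has_real_derivative f' \<beta>) (at \<beta>)"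
      "\<And>\<beta>. \<bar>f' \<beta>\<bar> \<le> real l"
    using ln_chain_Z_deriv[of l] by metis
  have "norm (ln (chain_Z r \<beta> l) - ln (chain_Z r 0 l)) \<le> real l * norm (\<beta> - 0)"
    using f' by (intro field_differentiable_bound[of UNIV _ f']) auto
  then show ?thesis by simp
qed

section \<open>Expectations over one chain and over disjoint chains\<close>

text \<open>The parameter \<open>m\<close> makes the induction work: integrating out the last spin
  trades one unit of \<open>l\<close> for one unit of \<open>m\<close>.\<close>

lemma integral_chain_weight:
  "(LINT \<sigma>|PiM {..l} (\<lambda>_. spin_measure r).
      exp (\<beta> * (\<Sum>k<l. \<sigma> k * \<sigma> (Suc k))) * chain_weight r \<beta> m (\<sigma> l)) = chain_Z r \<beta> (l + m)"
proof (induction l arbitrary: m)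
  case 0
  interpret product_sigma_finite "\<lambda>_ :: nat. spin_measure r" ..
  have [measurable]: "(\<lambda>\<sigma>. chain_weight r \<beta> m (\<sigma> 0)) \<in> borel_measurable (PiM {0::nat} (\<lambda>_. spin_measure r))"
    by (rule measurable_spin_compose) simp
  have "(LINT \<sigma>|PiM {0::nat} (\<lambda>_. spin_measure r). chain_weight r \<beta> m (\<sigma> 0))
      = (LINT s|spin_measure r. chain_weight r \<beta> m s)"
    by (rule product_integral_singleton[where i = 0]) simp
  then show ?case
    using r_pos r_less_1 by (simp add: atMost_0 integral_spin_measure chain_Z_def)
next
  case (Suc l)
  interpret product_sigma_finite "\<lambda>_ :: nat. spin_measure r" ..
  let ?f = "\<lambda>\<sigma>. exp (\<beta> * (\<Sum>k<Suc l. \<sigma> k * \<sigma> (Suc k))) * chain_weight r \<beta> m (\<sigma> (Suc l))"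
  have coord: "(\<lambda>\<sigma>. \<sigma> k) \<in> borel_measurable (PiM {..Suc l} (\<lambda>_. spin_measure r))" if "k \<le> Suc l" for k
    using that by (intro measurable_spin_coordinate) simp
  have "(\<lambda>\<sigma>. chain_weight r \<beta> m (\<sigma> (Suc l))) \<in> borel_measurable (PiM {..Suc l} (\<lambda>_. spin_measure r))"
    by (rule measurable_spin_compose) simp
  then have "?f \<in> borel_measurable (PiM {..Suc l} (\<lambda>_. spin_measure r))"
    by (intro borel_measurable_times borel_measurable_exp borel_measurable_sum borel_measurable_const
        measurable_compose[OF _ borel_measurable_exp] coord) auto
  then have int: "integrable (PiM (insert (Suc l) {..l}) (\<lambda>_. spin_measure r)) ?f"
    unfolding atMost_Suc[symmetric] by (intro integrable_finite_spins) auto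
  have "(LINT \<sigma>|PiM {..Suc l} (\<lambda>_. spin_measure r). ?f \<sigma>)
      = (LINT \<sigma>|PiM {..l} (\<lambda>_. spin_measure r). LINT s|spin_measure r. ?f (\<sigma>(Suc l := s)))"
    unfolding atMost_Suc by (rule product_integral_insert[OF _ _ int]) auto
  also have "\<dots> = (LINT \<sigma>|PiM {..l} (\<lambda>_. spin_measure r).
      exp (\<beta> * (\<Sum>k<l. \<sigma> k * \<sigma> (Suc k))) * chain_weight r \<beta> (Suc m) (\<sigma> l))"
  proof (rule Bochner_Integration.integral_cong[OF refl])
    fix \<sigma> :: "nat \<Rightarrow> real"
    have "(\<Sum>k<l. (\<sigma>(Suc l := s)) k * (\<sigma>(Suc l := s)) (Suc k)) = (\<Sum>k<l. \<sigma> k * \<sigma> (Suc k))" for s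
      by (intro sum.cong) auto
    then have "?f (\<sigma>(Suc l := s)) = exp (\<beta> * (\<Sum>k<l. \<sigma> k * \<sigma> (Suc k))) * exp (\<beta> * (\<sigma> l * s)) * chain_weight r \<beta> m s" for s
      by (simp add: distrib_left exp_add)
    then show "(LINT s|spin_measure r. ?f (\<sigma>(Suc l := s)))
        = exp (\<beta> * (\<Sum>k<l. \<sigma> k * \<sigma> (Suc k))) * chain_weight r \<beta> (Suc m) (\<sigma> l)"
      using r_pos r_less_1 by (simp only: integral_spin_measure) (simp add: algebra_simps)
  qed
  also have "\<dots> = chain_Z r \<beta> (Suc l + m)" using Suc.IH[of "Suc m"] by simp
  finally show ?case .
qed

text \<open>Spins read along an injective path again have the product law, which moves any chain to
  the sites 0, ..., l.\<close>

lemma integral_chain: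
  fixes q :: "nat \<Rightarrow> 'i"
  assumes inj: "inj_on q {..l}" and q: "q ` {..l} \<subseteq> J"
  shows "(LINT \<sigma>|PiM J (\<lambda>_. spin_measure r). exp (\<beta> * (\<Sum>k<l. \<sigma> (q k) * \<sigma> (q (Suc k))))) = chain_Z r \<beta> l"
proof -
  have [measurable]: "(\<lambda>\<sigma>. exp (\<beta> * (\<Sum>k<l. \<sigma> k * \<sigma> (Suc k)))) \<in> borel_measurable (PiM {..l} (\<lambda>_. spin_measure r))"
    by (intro borel_measurable_times borel_measurable_sum borel_measurable_const
        measurable_compose[OF _ borel_measurable_exp] measurable_spin_coordinate) auto
  have [measurable]: "(\<lambda>\<sigma>. \<lambda>n\<in>{..l}. \<sigma> (q n)) \<in> measurable (PiM J (\<lambda>_. spin_measure r)) (PiM {..l} (\<lambda>_. spin_measure r))"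
    using q by (intro measurable_restrict measurable_component_singleton) auto
  have "chain_Z r \<beta> l = (LINT \<sigma>|PiM {..l} (\<lambda>_. spin_measure r). exp (\<beta> * (\<Sum>k<l. \<sigma> k * \<sigma> (Suc k))))"
    using integral_chain_weight[of l \<beta> 0] by simp
  also have "PiM {..l} (\<lambda>_. spin_measure r)
      = distr (PiM J (\<lambda>_. spin_measure r)) (PiM {..l} (\<lambda>_. spin_measure r)) (\<lambda>\<sigma>. \<lambda>n\<in>{..l}. \<sigma> (q n))"
    using q by (intro distr_PiM_reindex[symmetric] inj spin.prob_space_axioms) auto
  also have "(LINT \<sigma>|\<dots>. exp (\<beta> * (\<Sum>k<l. \<sigma> k * \<sigma> (Suc k))))
      = (LINT \<sigma>|PiM J (\<lambda>_. spin_measure r). exp (\<beta> * (\<Sum>k<l. \<sigma> (q k) * \<sigma> (q (Suc k)))))"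
    by (subst integral_distr) (auto intro!: Bochner_Integration.integral_cong arg_cong[where f = exp] sum.cong)
  finally show ?thesis by simp
qed

lemma indep_spins:
  fixes J :: "'i set"
  assumes "J \<noteq> {}"
  shows "prob_space.indep_vars (PiM J (\<lambda>_. spin_measure r)) (\<lambda>_. spin_measure r) (\<lambda>i \<sigma>. \<sigma> i) J"
proof (subst prob_space.indep_vars_iff_distr_eq_PiM')
  show "prob_space (PiM J (\<lambda>_. spin_measure r))"
    by (rule prob_space_spins)
  have "distr (PiM J (\<lambda>_. spin_measure r)) (PiM J (\<lambda>_. spin_measure r)) (\<lambda>\<sigma>. \<lambda>i\<in>J. \<sigma> i)
      = distr (PiM J (\<lambda>_. spin_measure r)) (PiM J (\<lambda>_. spin_measure r)) (\<lambda>\<sigma>. \<sigma>)"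
    by (intro distr_cong refl) (simp add: space_PiM PiE_restrict)
  also have "\<dots> = PiM J (\<lambda>_. spin_measure r)" by (rule distr_id)
  also have "\<dots> = PiM J (\<lambda>i. distr (PiM J (\<lambda>_. spin_measure r)) (spin_measure r) (\<lambda>\<sigma>. \<sigma> i))"
    by (intro PiM_cong refl distr_PiM_component[symmetric] spin.prob_space_axioms)
  finally show "distr (PiM J (\<lambda>_. spin_measure r)) (PiM J (\<lambda>_. spin_measure r)) (\<lambda>\<sigma>. \<lambda>i\<in>J. \<sigma> i)
      = PiM J (\<lambda>i. distr (PiM J (\<lambda>_. spin_measure r)) (spin_measure r) (\<lambda>\<sigma>. \<sigma> i))" .
qed (use assms in auto)

text \<open>The energies of different chains depend on disjoint sets of coordinates, so their
  exponentials are independent and the expectation factorises.\<close>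

lemma integral_disjoint_chains:
  fixes q :: "'j \<Rightarrow> nat \<Rightarrow> 'i"
  assumes "finite A" "J \<noteq> {}"
    and inj: "inj_on (\<lambda>(i, k). q i k) (A \<times> UNIV)" and q: "\<And>i k. i \<in> A \<Longrightarrow> q i k \<in> J"
  shows "(LINT \<sigma>|PiM J (\<lambda>_. spin_measure r).
            exp (\<beta> * (\<Sum>i\<in>A. \<Sum>k<len i. \<sigma> (q i k) * \<sigma> (q i (Suc k)))))
       = (\<Prod>i\<in>A. chain_Z r \<beta> (len i))"
proof -
  let ?M = "PiM J (\<lambda>_. spin_measure r)"
  interpret M: prob_space ?M
    by (rule prob_space_spins)
  \<comment> \<open>A chain with \<open>len i\<close> bonds involves \<open>len i + 1\<close> sites,
    hence the closed range of indices.\<close>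
  define K where "K i = q i ` {..len i}" for i
  define Y where "Y i \<sigma> = exp (\<beta> * (\<Sum>k<len i. \<sigma> (q i k) * \<sigma> (q i (Suc k))))" for i \<sigma>
  have KJ: "K i \<subseteq> J" if "i \<in> A" for i using q that by (auto simp: K_def)
  have disj: "disjoint_family_on K A"
    using inj by (force simp: disjoint_family_on_def K_def inj_on_def)
  have Y_meas: "Y i \<in> borel_measurable (PiM (K i) (\<lambda>_. spin_measure r))" for i
    unfolding Y_def K_def
    by (intro borel_measurable_times borel_measurable_sum borel_measurable_const
        measurable_compose[OF _ borel_measurable_exp] measurable_spin_coordinate) auto
  have Y_restrict: "Y i (restrict \<sigma> (K i)) = Y i \<sigma>" for i \<sigma>
    unfolding Y_def K_def by (auto intro!: sum.cong)
  have "M.indep_vars (\<lambda>_. borel) (\<lambda>i \<sigma>. Y i (restrict (\<lambda>j. \<sigma> j) (K i))) A"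
    by (intro M.indep_vars_compose2[OF M.indep_vars_restrict[OF indep_spins[OF \<open>J \<noteq> {}\<close>] KJ disj]] Y_meas)
  then have indep: "M.indep_vars (\<lambda>_. borel) Y A"
    by (simp add: Y_restrict)
  have Y_int: "integrable ?M (Y i)" if "i \<in> A" for i
  proof (rule M.integrable_const_bound[where B = "exp (\<bar>\<beta>\<bar> * real (len i))"])
    show "Y i \<in> borel_measurable ?M" using indep that unfolding M.indep_vars_def2 by blast
    show "AE \<sigma> in ?M. norm (Y i \<sigma>) \<le> exp (\<bar>\<beta>\<bar> * real (len i))"
    proof (intro AE_I2)
      fix \<sigma> assume \<sigma>: "\<sigma> \<in> space ?M"
      have abs1: "\<bar>\<sigma> (q i k)\<bar> = 1" for k
      proof -
        have "\<sigma> (q i k) \<in> {1, -1}" using \<sigma> q[OF that] by (auto simp: space_PiM PiE_iff)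
        then show ?thesis by auto
      qed
      have "\<beta> * (\<Sum>k<len i. \<sigma> (q i k) * \<sigma> (q i (Suc k)))
          \<le> \<bar>\<beta>\<bar> * \<bar>\<Sum>k<len i. \<sigma> (q i k) * \<sigma> (q i (Suc k))\<bar>"
        by (metis abs_ge_self abs_mult)
      also have "\<dots> \<le> \<bar>\<beta>\<bar> * (\<Sum>k<len i. \<bar>\<sigma> (q i k) * \<sigma> (q i (Suc k))\<bar>)"
        by (intro mult_left_mono sum_abs) auto
      also have "\<dots> = \<bar>\<beta>\<bar> * real (len i)" by (simp add: abs_mult abs1)
      finally show "norm (Y i \<sigma>) \<le> exp (\<bar>\<beta>\<bar> * real (len i))" by (simp add: Y_def)
    qed
  qed
  have "(LINT \<sigma>|?M. exp (\<beta> * (\<Sum>i\<in>A. \<Sum>k<len i. \<sigma> (q i k) * \<sigma> (q i (Suc k)))))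
      = (LINT \<sigma>|?M. (\<Prod>i\<in>A. Y i \<sigma>))"
    by (simp add: Y_def sum_distrib_left exp_sum \<open>finite A\<close>)
  also have "\<dots> = (\<Prod>i\<in>A. LINT \<sigma>|?M. Y i \<sigma>)"
    by (rule M.indep_vars_lebesgue_integral[OF \<open>finite A\<close> indep Y_int])
  also have "\<dots> = (\<Prod>i\<in>A. chain_Z r \<beta> (len i))"
  proof (rule prod.cong[OF refl])
    fix i assume i: "i \<in> A"
    have "inj_on (q i) {..len i}" using inj i by (force simp: inj_on_def)
    then show "(LINT \<sigma>|?M. Y i \<sigma>) = chain_Z r \<beta> (len i)"
      unfolding Y_def using q[OF i] by (intro integral_chain) auto
  qed
  finally show ?thesis .
qed

end

section \<open>Decomposition of a box into chains\<close>

lemma filterlim_boxes_coordinate: "filterlim (\<lambda>N. N j) at_top (boxes_at_top :: ('d::finite) index filter)"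
  unfolding filterlim_def filtermap_le_iff_le_filtercomap boxes_at_top_def by (rule INF_lower) simp

text \<open>The cubes with all sides equal to n run along this filter.\<close>

lemma boxes_at_top_nontrivial: "(boxes_at_top :: ('d::finite) index filter) \<noteq> bot"
proof
  assume "(boxes_at_top :: 'd index filter) = bot"
  moreover have "filterlim (\<lambda>n _. n) (boxes_at_top :: 'd index filter) sequentially"
    unfolding boxes_at_top_def
    by (simp add: filterlim_INF filterlim_filtercomap_iff comp_def filterlim_ident)
  ultimately show False
    by (simp add: filterlim_def bot_unique filtermap_bot_iff)
qed

lemma eventually_boxes_ge: "eventually (\<lambda>N. \<forall>j. n \<le> N j) (boxes_at_top :: ('d::finite) index filter)"
  using filterlim_boxes_coordinate unfolding filterlim_at_top by (intro eventually_all_finite) blast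

lemma filterlim_box_volume: "filterlim box_volume at_top (boxes_at_top :: ('d::finite) index filter)"
proof (rule filterlim_at_top_mono)
  fix j :: 'd
  show "filterlim (\<lambda>N. real (N j)) at_top boxes_at_top"
    by (rule filterlim_compose[OF filterlim_real_sequentially filterlim_boxes_coordinate])
  show "eventually (\<lambda>N. real (N j) \<le> box_volume N) boxes_at_top"
    using eventually_boxes_ge[of 1]
  proof eventually_elim
    case (elim N)
    then have "1 \<le> (\<Prod>k\<in>UNIV - {j}. real (N k))" by (intro prod_ge_1) simp
    then have "real (N j) * 1 \<le> real (N j) * (\<Prod>k\<in>UNIV - {j}. real (N k))"
      by (intro mult_left_mono) auto
    also have "\<dots> = box_volume N"
      by (simp add: box_volume_def prod.remove[of UNIV j])
    finally show ?case by simp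
  qed
qed

lemma index_box_eq_PiE: "index_box N = PiE UNIV (\<lambda>j. {1..N j})"
  by (auto simp: index_box_def PiE_def)

lemma finite_index_box [simp]: "finite (index_box N)"
  unfolding index_box_eq_PiE by (intro finite_PiE) auto

lemma card_index_box: "card (index_box N) = (\<Prod>j\<in>UNIV. N j)"
  unfolding index_box_eq_PiE by (subst card_PiE) auto

lemma index_box_subset_pos: "index_box N \<subseteq> pos_indices"
  by (auto simp: index_box_def pos_indices_def)

lemma tendsto_nat_div_ratio:
  assumes "0 < c"
  shows "((\<lambda>n. real (n div c) / real n) \<longlongrightarrow> 1 / real c) at_top"
proof (rule tendsto_sandwich)
  have lower: "1 / real c - 1 / real n \<le> real (n div c) / real n" if "0 < n" for n
  proof -
    have "real n = real c * real (n div c) + real (n mod c)"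
      by (metis mult_div_mod_eq of_nat_add of_nat_mult)
    moreover have "real (n mod c) < real c" using assms by simp
    ultimately have "real n \<le> real c * (real (n div c) + 1)" by (simp add: algebra_simps)
    then have "1 / real c \<le> (real (n div c) + 1) / real n"
      using assms that by (simp add: field_simps)
    then show ?thesis by (simp add: add_divide_distrib)
  qed
  show "eventually (\<lambda>n. 1 / real c - 1 / real n \<le> real (n div c) / real n) at_top"
    using eventually_gt_at_top[of 0] by eventually_elim (rule lower)
  have upper: "real (n div c) / real n \<le> 1 / real c" if "0 < n" for n
  proof -
    have "real (n div c) / real n \<le> (real n / real c) / real n"
      by (intro divide_right_mono of_nat_div_le_of_nat) simp
    then show ?thesis using that by simp
  qed
  show "eventually (\<lambda>n. real (n div c) / real n \<le> 1 / real c) at_top"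
    using eventually_gt_at_top[of 0] by eventually_elim (rule upper)
  have "((\<lambda>n. 1 / real c - 1 / real n) \<longlongrightarrow> 1 / real c - 0) at_top"
    by (intro tendsto_intros lim_1_over_n)
  then show "((\<lambda>n. 1 / real c - 1 / real n) \<longlongrightarrow> 1 / real c) at_top" by simp
qed simp

section \<open>Chains of sites and their lengths\<close>

definition chain_pt :: "('d::finite) index \<Rightarrow> 'd index \<Rightarrow> nat \<Rightarrow> 'd index" where
  "chain_pt p i k = (\<lambda>j. p j ^ k * i j)"

definition chain_roots :: "('d::finite) index \<Rightarrow> 'd index \<Rightarrow> 'd index set" where
  "chain_roots p N = {i \<in> index_box N. \<not> (\<forall>j. p j dvd i j)}"

text \<open>The number of sites in the box is also the number of bonds: every site of the box starts
  one bond, and the last bond ends outside.\<close>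

definition chain_len :: "('d::finite) index \<Rightarrow> 'd index \<Rightarrow> 'd index \<Rightarrow> nat" where
  "chain_len p N i = card {k. chain_pt p i k \<in> index_box N}"

text \<open>A root lies in the box, so lengths start at 1; the shift by one lets series run from
  0.\<close>

definition chain_count :: "('d::finite) index \<Rightarrow> 'd index \<Rightarrow> nat \<Rightarrow> nat" where
  "chain_count p N m = card {i \<in> chain_roots p N. chain_len p N i = Suc m}"

text \<open>This is the number of sites whose m-th successor is still in the box.\<close>

definition shrunk_volume :: "('d::finite) index \<Rightarrow> 'd index \<Rightarrow> nat \<Rightarrow> real" where
  "shrunk_volume p N m = (\<Prod>j\<in>UNIV. real (N j div p j ^ m))"

locale expanding_index =
  fixes p :: "('d::finite) index"
  assumes p_pos: "\<And>j. 1 \<le> p j" and p_prod: "2 \<le> (\<Prod>j\<in>UNIV. p j)"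
begin

lemma obtain_expanding_coordinate: obtains j where "2 \<le> p j"
proof -
  have "\<exists>j. p j \<noteq> 1"
  proof (rule ccontr)
    assume "\<not> ?thesis"
    then show False using p_prod by simp
  qed
  then obtain j where "p j \<noteq> 1" by blast
  then have "2 \<le> p j" using p_pos[of j] by simp
  then show thesis by (rule that)
qed

lemma chain_pt_0 [simp]: "chain_pt p i 0 = i"
  by (simp add: chain_pt_def)

lemma chain_pt_Suc: "chain_pt p i (Suc k) = (\<lambda>j. p j * chain_pt p i k j)"
  by (simp add: chain_pt_def mult.assoc)

lemma chain_pt_add: "chain_pt p i (k + l) = chain_pt p (chain_pt p i k) l"
  by (simp add: chain_pt_def power_add mult_ac)

lemma chain_pt_inj: "chain_pt p i k = chain_pt p i' k \<Longrightarrow> i = i'"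
proof
  fix j assume "chain_pt p i k = chain_pt p i' k"
  then have "p j ^ k * i j = p j ^ k * i' j" by (auto simp: chain_pt_def dest: fun_cong[of _ _ j])
  then show "i j = i' j" using p_pos[of j] by simp
qed

lemma chain_pt_in_pos_iff: "chain_pt p i k \<in> pos_indices \<longleftrightarrow> i \<in> pos_indices"
  using p_pos by (force simp: pos_indices_def chain_pt_def)

lemma chain_pt_in_box_iff: "chain_pt p i m \<in> index_box N \<longleftrightarrow> i \<in> index_box (\<lambda>j. N j div p j ^ m)"
proof -
  have "1 \<le> p j ^ m * i j \<longleftrightarrow> 1 \<le> i j" "p j ^ m * i j \<le> N j \<longleftrightarrow> i j \<le> N j div p j ^ m" for j
    using p_pos[of j] by (auto simp: less_eq_div_iff_mult_less_eq mult.commute)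
  then show ?thesis by (simp add: index_box_def chain_pt_def)
qed

lemma chain_pt_le: "i j \<le> chain_pt p i k j"
  using p_pos[of j] by (simp add: chain_pt_def)

lemma chain_pt_mono: "k \<le> l \<Longrightarrow> chain_pt p i k j \<le> chain_pt p i l j"
  using chain_pt_le[of "chain_pt p i k" j "l - k"] by (simp flip: chain_pt_add)

lemma chain_pt_in_box_antimono:
  assumes "k \<le> l" "chain_pt p i l \<in> index_box N"
  shows "chain_pt p i k \<in> index_box N"
  unfolding index_box_def
proof (intro CollectI allI)
  fix j
  have "i \<in> pos_indices" using assms(2) index_box_subset_pos chain_pt_in_pos_iff by blast
  then have "chain_pt p i k \<in> pos_indices" by (simp add: chain_pt_in_pos_iff)
  then show "chain_pt p i k j \<in> {1..N j}"
    using assms(2) chain_pt_mono[OF assms(1), of i j]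
    by (auto simp: index_box_def pos_indices_def intro: order.trans)
qed

text \<open>Along a coordinate with factor at least 2, the \<open>N j\<close>-th successor is too
  large because \<open>n < 2 ^ n\<close>.\<close>

lemma chain_escapes:
  assumes "i \<in> pos_indices"
  shows "\<exists>k. chain_pt p i k \<notin> index_box N"
proof -
  obtain j where j: "2 \<le> p j" by (rule obtain_expanding_coordinate)
  have "N j < 2 ^ N j" by simp
  also have "\<dots> \<le> p j ^ N j * i j"
    using mult_mono[OF power_mono[OF j, of "N j"], of 1 "i j"] assms by (simp add: pos_indices_def)
  finally have "\<not> chain_pt p i (N j) j \<le> N j" by (simp add: chain_pt_def)
  then show ?thesis by (auto simp: index_box_def)
qed

text \<open>The admissible exponents form an initial segment, which is finite because chains escape;
  its cardinality is the first exit time.\<close>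

lemma less_chain_len_iff:
  assumes "i \<in> pos_indices"
  shows "k < chain_len p N i \<longleftrightarrow> chain_pt p i k \<in> index_box N"
proof -
  define n where "n = (LEAST k. chain_pt p i k \<notin> index_box N)"
  have n: "chain_pt p i n \<notin> index_box N"
    unfolding n_def by (rule LeastI_ex[OF chain_escapes[OF assms]])
  have iff: "chain_pt p i k \<in> index_box N \<longleftrightarrow> k < n" for k
    using n chain_pt_in_box_antimono[of n k i N] not_less_Least[of k "\<lambda>k. chain_pt p i k \<notin> index_box N"]
    by (fold n_def) (meson not_less)
  have "{k. chain_pt p i k \<in> index_box N} = {..<n}"
    using iff by auto
  then show ?thesis using iff by (simp add: chain_len_def)
qed

lemma finite_chain_roots [simp]: "finite (chain_roots p N)"
  by (simp add: chain_roots_def)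

lemma chain_roots_pos: "i \<in> chain_roots p N \<Longrightarrow> i \<in> pos_indices"
  using index_box_subset_pos by (auto simp: chain_roots_def)

text \<open>Cancelling the common power of \<open>p\<close> exhibits one root as a successor of the
  other root. A proper successor is a multiple of \<open>p\<close>, which a root is not.\<close>

lemma chain_inj: "inj_on (\<lambda>(i, k). chain_pt p i k) (chain_roots p N \<times> UNIV)"
proof -
  have main: "i = i' \<and> k = k'"
    if "i \<in> chain_roots p N" "chain_pt p i k = chain_pt p i' k'" "k \<le> k'" for i i' k k'
  proof -
    have "chain_pt p i' k' = chain_pt p (chain_pt p i' (k' - k)) k"
      using that(3) by (simp flip: chain_pt_add)
    then have i: "i = chain_pt p i' (k' - k)"
      using that(2) chain_pt_inj by metis
    show ?thesis
    proof (cases "k' - k")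
      case 0
      then show ?thesis using i that(3) by simp
    next
      case (Suc l)
      then have "\<forall>j. p j dvd i j" using i by (simp add: chain_pt_Suc)
      then show ?thesis using that(1) by (simp add: chain_roots_def)
    qed
  qed
  show ?thesis
  proof (rule inj_onI, clarify)
    fix i k i' k'
    assume "i \<in> chain_roots p N" "i' \<in> chain_roots p N" "chain_pt p i k = chain_pt p i' k'"
    then show "i = i' \<and> k = k'"
      using main[of i k i' k'] main[of i' k' i k] by (metis nat_le_linear)
  qed
qed

text \<open>Descent: dividing by \<open>p\<close> while possible strictly decreases the sum of the
  coordinates.\<close>

lemma chain_surj:
  assumes "i \<in> index_box N"
  shows "\<exists>i0 k. i0 \<in> chain_roots p N \<and> i = chain_pt p i0 k"
  using assms
proof (induction "\<Sum>j\<in>UNIV. i j" arbitrary: i rule: less_induct)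
  case less
  show ?case
  proof (cases "i \<in> chain_roots p N")
    case True
    then show ?thesis by (metis chain_pt_0)
  next
    case False
    then have dvd: "\<forall>j. p j dvd i j" using less.prems by (simp add: chain_roots_def)
    define i' where "i' j = i j div p j" for j
    have i: "i = chain_pt p i' 1" using dvd by (auto simp: chain_pt_def i'_def)
    have i'_box: "i' \<in> index_box N"
      using chain_pt_in_box_antimono[of 0 1 i' N] less.prems i by simp
    obtain j where j: "2 \<le> p j" by (rule obtain_expanding_coordinate)
    have "i' j < i j"
    proof -
      have "1 \<le> i j" using less.prems by (simp add: index_box_def)
      then show ?thesis using j by (simp add: i'_def)
    qed
    then have "(\<Sum>j\<in>UNIV. i' j) < (\<Sum>j\<in>UNIV. i j)"
      by (intro sum_strict_mono_ex1) (auto simp: i'_def)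
    from less.hyps[OF this i'_box] obtain i0 k where "i0 \<in> chain_roots p N" "i' = chain_pt p i0 k"
      by blast
    then show ?thesis using i by (metis chain_pt_add)
  qed
qed

lemma sum_index_box:
  "(\<Sum>i\<in>index_box N. f i) = (\<Sum>i\<in>chain_roots p N. \<Sum>k<chain_len p N i. f (chain_pt p i k))"
proof -
  let ?S = "SIGMA i:chain_roots p N. {..<chain_len p N i}"
  have "bij_betw (\<lambda>(i, k). chain_pt p i k) ?S (index_box N)"
    unfolding bij_betw_def
  proof
    show "inj_on (\<lambda>(i, k). chain_pt p i k) ?S"
      by (rule inj_on_subset[OF chain_inj]) auto
    show "(\<lambda>(i, k). chain_pt p i k) ` ?S = index_box N"
    proof
      show "(\<lambda>(i, k). chain_pt p i k) ` ?S \<subseteq> index_box N"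
        using less_chain_len_iff chain_roots_pos by auto
      show "index_box N \<subseteq> (\<lambda>(i, k). chain_pt p i k) ` ?S"
      proof
        fix i assume i: "i \<in> index_box N"
        then obtain i0 k where "i0 \<in> chain_roots p N" "i = chain_pt p i0 k"
          using chain_surj by blast
        then show "i \<in> (\<lambda>(i, k). chain_pt p i k) ` ?S"
          using i less_chain_len_iff chain_roots_pos by (auto intro!: image_eqI[of _ _ "(i0, k)"])
      qed
    qed
  qed
  then have "(\<Sum>i\<in>index_box N. f i) = (\<Sum>x\<in>?S. f (case x of (i, k) \<Rightarrow> chain_pt p i k))"
    by (rule sum.reindex_bij_betw[symmetric])
  also have "\<dots> = (\<Sum>i\<in>chain_roots p N. \<Sum>k<chain_len p N i. f (chain_pt p i k))"
    by (subst sum.Sigma) (auto intro!: sum.cong)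
  finally show ?thesis .
qed

lemma multiple_sum_chains:
  "multiple_sum p N \<sigma> = (\<Sum>i\<in>chain_roots p N. \<Sum>k<chain_len p N i.
     \<sigma> (chain_pt p i k) * \<sigma> (chain_pt p i (Suc k)))"
  unfolding multiple_sum_def sum_index_box by (simp add: chain_pt_Suc)

section \<open>Limiting densities of the chain lengths\<close>

lemma card_shrunk_box: "real (card {i. chain_pt p i m \<in> index_box N}) = shrunk_volume p N m"
  by (simp add: chain_pt_in_box_iff card_index_box shrunk_volume_def)

text \<open>Let \<open>B m\<close> be the sites with m-th successor in the box. Those in
  \<open>B m - B (Suc m)\<close> have exactly m further sites of the box ahead. The ones that are
  not roots are multiples of \<open>p\<close>, hence the bijective image under \<open>g\<close> of
  the same difference one level higher.\<close>

lemma chain_count_eq: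
  "real (chain_count p N m) = shrunk_volume p N m - 2 * shrunk_volume p N (m + 1) + shrunk_volume p N (m + 2)"
proof -
  define B where "B m = {i. chain_pt p i m \<in> index_box N}" for m
  have fin: "finite (B m)" for m by (simp add: B_def chain_pt_in_box_iff)
  have sub: "B (Suc m) \<subseteq> B m" for m
    using chain_pt_in_box_antimono[of m "Suc m"] by (auto simp: B_def)
  have card_diff: "real (card (B m - B (Suc m))) = shrunk_volume p N m - shrunk_volume p N (Suc m)" for m
    using sub[of m] fin card_mono[OF fin sub[of m]]
    by (simp add: card_Diff_subset of_nat_diff card_shrunk_box[symmetric] B_def)
  let ?R = "{i. \<forall>j. p j dvd i j}"
  define g where "g i = chain_pt p i 1" for i
  have shift: "g i \<in> B k \<longleftrightarrow> i \<in> B (Suc k)" for i k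
    using chain_pt_add[of i 1 k] by (simp add: B_def g_def)
  have "{i \<in> chain_roots p N. chain_len p N i = Suc m} = (B m - B (Suc m)) - ?R"
  proof (intro set_eqI iffI)
    fix i assume "i \<in> {i \<in> chain_roots p N. chain_len p N i = Suc m}"
    then show "i \<in> (B m - B (Suc m)) - ?R"
      using less_chain_len_iff[of i m N] less_chain_len_iff[of i "Suc m" N] chain_roots_pos[of i N]
      by (auto simp: B_def chain_roots_def)
  next
    fix i assume i: "i \<in> (B m - B (Suc m)) - ?R"
    then have box: "i \<in> index_box N"
      using chain_pt_in_box_antimono[of 0 m i N] by (simp add: B_def)
    then have "i \<in> pos_indices" using index_box_subset_pos by blast
    then have "m < chain_len p N i" "\<not> Suc m < chain_len p N i"
      using i unfolding B_def by (simp_all add: less_chain_len_iff)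
    with box show "i \<in> {i \<in> chain_roots p N. chain_len p N i = Suc m}"
      using i by (auto simp: chain_roots_def)
  qed
  also have "\<dots> = (B m - B (Suc m)) - g ` (B (Suc m) - B (Suc (Suc m)))"
  proof -
    have "i \<in> ?R \<longleftrightarrow> i \<in> g ` (B (Suc m) - B (Suc (Suc m)))" if i: "i \<in> B m - B (Suc m)" for i
    proof
      assume "i \<in> ?R"
      then have "i = g (\<lambda>j. i j div p j)" by (auto simp: g_def chain_pt_def)
      then show "i \<in> g ` (B (Suc m) - B (Suc (Suc m)))"
        using i shift[of "\<lambda>j. i j div p j"] by (intro image_eqI) auto
    qed (auto simp: g_def chain_pt_def)
    then show ?thesis by blast
  qed
  finally have "chain_count p N m
      = card ((B m - B (Suc m)) - g ` (B (Suc m) - B (Suc (Suc m))))"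
    by (simp add: chain_count_def)
  also have "real \<dots> = real (card (B m - B (Suc m)))
      - real (card (g ` (B (Suc m) - B (Suc (Suc m)))))"
  proof -
    have sub': "g ` (B (Suc m) - B (Suc (Suc m))) \<subseteq> B m - B (Suc m)"
      using shift by auto
    have fin': "finite (B m - B (Suc m))" using fin by simp
    show ?thesis
      using card_mono[OF fin' sub'] finite_subset[OF sub' fin']
      by (subst card_Diff_subset) (auto simp: sub' of_nat_diff)
  qed
  also have "card (g ` (B (Suc m) - B (Suc (Suc m)))) = card (B (Suc m) - B (Suc (Suc m)))"
    using chain_pt_inj[where k = 1] by (intro card_image) (auto simp: inj_on_def g_def)
  finally show ?thesis by (simp add: card_diff)
qed

lemma index_prod_ge_2: "2 \<le> index_prod p"
  using of_nat_mono[OF p_prod, where 'a = real] by (simp only: index_prod_def of_nat_numeral)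

lemma shrunk_volume_le: "shrunk_volume p N m \<le> box_volume N / index_prod p ^ m"
proof -
  have "real (N j div p j ^ m) \<le> real (N j) / real (p j) ^ m" for j
    using of_nat_div_le_of_nat[of "N j" "p j ^ m"] by simp
  then have "shrunk_volume p N m \<le> (\<Prod>j\<in>UNIV. real (N j) / real (p j) ^ m)"
    unfolding shrunk_volume_def by (intro prod_mono) auto
  also have "\<dots> = box_volume N / index_prod p ^ m"
    by (simp add: box_volume_def index_prod_def prod_dividef prod_power_distrib)
  finally show ?thesis .
qed

lemma shrunk_volume_nonneg: "0 \<le> shrunk_volume p N m"
  unfolding shrunk_volume_def by (intro prod_nonneg) auto

lemma shrunk_volume_antimono: "shrunk_volume p N (Suc m) \<le> shrunk_volume p N m"
proof -
  have "N j div p j ^ Suc m \<le> N j div p j ^ m" for j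
    using p_pos[of j] by (intro div_le_mono2) auto
  then show ?thesis unfolding shrunk_volume_def by (intro prod_mono) auto
qed

text \<open>The second difference is at most its first term, as shrunk volumes are nonnegative and
  decreasing. The bound is uniform in \<open>N\<close>, including boxes of volume 0, where the
  quotient is 0.\<close>

lemma chain_density_bound: "real (chain_count p N m) / box_volume N \<le> (1 / index_prod p) ^ m"
proof -
  have "real (chain_count p N m) \<le> box_volume N / index_prod p ^ m"
    using shrunk_volume_le[of N m] shrunk_volume_antimono[of N "Suc m"] shrunk_volume_nonneg[of N "Suc m"]
    by (simp add: chain_count_eq)
  moreover have "0 \<le> box_volume N" unfolding box_volume_def by (intro prod_nonneg) auto
  ultimately show ?thesis
    using index_prod_ge_2 by (cases "box_volume N = 0") (auto simp: field_simps)
qed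

lemma shrunk_volume_tendsto:
  "((\<lambda>N. shrunk_volume p N m / box_volume N) \<longlongrightarrow> 1 / index_prod p ^ m) boxes_at_top"
proof -
  have "((\<lambda>N. real (N j div p j ^ m) / real (N j)) \<longlongrightarrow> 1 / real (p j ^ m)) boxes_at_top" for j
    using filterlim_compose[OF tendsto_nat_div_ratio[of "p j ^ m"] filterlim_boxes_coordinate[of j]] p_pos[of j]
    by simp
  then have "((\<lambda>N. \<Prod>j\<in>UNIV. real (N j div p j ^ m) / real (N j)) \<longlongrightarrow> (\<Prod>j\<in>UNIV. 1 / real (p j ^ m))) boxes_at_top"
    by (intro tendsto_prod)
  then show ?thesis
    by (simp add: shrunk_volume_def box_volume_def index_prod_def prod_dividef prod_power_distrib)
qed

text \<open>With \<open>l = m + 1\<close> bonds this is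
  \<open>(P - 1)^2 / P^(l + 1)\<close>.\<close>

definition chain_density :: "nat \<Rightarrow> real" where
  "chain_density m = (index_prod p - 1)^2 / index_prod p ^ (m + 2)"

lemma chain_density_tendsto:
  "((\<lambda>N. real (chain_count p N m) / box_volume N) \<longlongrightarrow> chain_density m) boxes_at_top"
proof -
  have "((\<lambda>N. shrunk_volume p N m / box_volume N - 2 * (shrunk_volume p N (m + 1) / box_volume N)
         + shrunk_volume p N (m + 2) / box_volume N)
       \<longlongrightarrow> 1 / index_prod p ^ m - 2 * (1 / index_prod p ^ (m + 1)) + 1 / index_prod p ^ (m + 2)) boxes_at_top"
    by (intro tendsto_intros shrunk_volume_tendsto)
  moreover have "1 / index_prod p ^ m - 2 * (1 / index_prod p ^ (m + 1)) + 1 / index_prod p ^ (m + 2) = chain_density m"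
    using index_prod_ge_2 by (simp add: chain_density_def field_simps power2_eq_square)
  ultimately show ?thesis
    by (simp add: chain_count_eq add_divide_distrib diff_divide_distrib)
qed

lemma chain_density_nonneg: "0 \<le> chain_density m"
  using index_prod_ge_2 by (simp add: chain_density_def)

text \<open>The total is the density of sites that start a chain, those that are not multiples of
  \<open>p\<close>.\<close>

lemma chain_density_sums: "chain_density sums ((index_prod p - 1) / index_prod p)"
proof -
  let ?P = "index_prod p"
  have "(\<lambda>m. (?P - 1)^2 / ?P^2 * (1 / ?P) ^ m) sums ((?P - 1)^2 / ?P^2 * (1 / (1 - 1 / ?P)))"
    using index_prod_ge_2 by (intro sums_mult geometric_sums) auto
  moreover have "(?P - 1)^2 / ?P^2 * (1 / (1 - 1 / ?P)) = (?P - 1) / ?P"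
  proof -
    have "1 - 1 / ?P = (?P - 1) / ?P" using index_prod_ge_2 by (simp add: diff_divide_distrib)
    then show ?thesis using index_prod_ge_2 by (simp add: power2_eq_square)
  qed
  moreover have "(\<lambda>m. (?P - 1)^2 / ?P^2 * (1 / ?P) ^ m) = chain_density"
    by (simp add: chain_density_def fun_eq_iff power_add power_one_over power2_eq_square field_simps)
  ultimately show ?thesis by simp
qed

text \<open>Each site of the box is the lower end of exactly one bond, so the mean number of bonds per
  site is \<open>1\<close>.\<close>

lemma chain_density_mean: "(\<lambda>m. real (Suc m) * chain_density m) sums 1"
proof -
  let ?P = "index_prod p"
  have "(\<lambda>m. (?P - 1)^2 / ?P^2 * (of_nat (Suc m) * (1 / ?P) ^ m)) sums ((?P - 1)^2 / ?P^2 * (1 / (1 - 1 / ?P)^2))"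
    using index_prod_ge_2 by (intro sums_mult geometric_deriv_sums) auto
  moreover have "(?P - 1)^2 / ?P^2 * (1 / (1 - 1 / ?P)^2) = 1"
  proof -
    have "1 - 1 / ?P = (?P - 1) / ?P" using index_prod_ge_2 by (simp add: diff_divide_distrib)
    then show ?thesis using index_prod_ge_2 by (simp add: power_divide)
  qed
  moreover have "(\<lambda>m. (?P - 1)^2 / ?P^2 * (of_nat (Suc m) * (1 / ?P) ^ m)) = (\<lambda>m. real (Suc m) * chain_density m)"
    by (simp add: chain_density_def fun_eq_iff power_add power_one_over power2_eq_square field_simps)
  ultimately show ?thesis by (simp only:)
qed

text \<open>Grouping by length gives a series over an index set independent of \<open>N\<close>, so
  that limits can be taken term by term. For each \<open>N\<close> only finitely many terms are
  nonzero.\<close>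

lemma sum_chain_roots:
  "(\<Sum>i\<in>chain_roots p N. g (chain_len p N i)) = (\<Sum>m. real (chain_count p N m) * g (Suc m))"
proof -
  let ?l = "\<lambda>i. chain_len p N i - 1"
  have len: "chain_len p N i = Suc (?l i)" if "i \<in> chain_roots p N" for i
  proof -
    have "0 < chain_len p N i"
      using that chain_roots_pos[OF that] by (simp add: less_chain_len_iff chain_roots_def)
    then show ?thesis by simp
  qed
  have count: "{i \<in> chain_roots p N. ?l i = m} = {i \<in> chain_roots p N. chain_len p N i = Suc m}" for m
    using len by force
  have "(\<Sum>i\<in>chain_roots p N. g (chain_len p N i))
      = (\<Sum>m\<in>?l ` chain_roots p N. \<Sum>i\<in>{i \<in> chain_roots p N. ?l i = m}. g (chain_len p N i))"
    by (rule sum.image_gen) simp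
  also have "\<dots> = (\<Sum>m\<in>?l ` chain_roots p N. real (chain_count p N m) * g (Suc m))"
    unfolding count by (intro sum.cong refl) (simp add: chain_count_def)
  also have "\<dots> = (\<Sum>m. real (chain_count p N m) * g (Suc m))"
  proof (rule suminf_finite[symmetric])
    fix m assume "m \<notin> ?l ` chain_roots p N"
    then have "{i \<in> chain_roots p N. ?l i = m} = {}" by auto
    then have "chain_count p N m = 0" unfolding count by (simp add: chain_count_def)
    then show "real (chain_count p N m) * g (Suc m) = 0" by simp
  qed simp
  finally show ?thesis .
qed

end

section \<open>Existence and differentiability of the limiting free energy\<close>

locale multiple_spin = expanding_index p + spin_bias r for p :: "('d::finite) index" and r :: real
begin

lemma integral_multiple_sum:
  "(LINT \<sigma>|bernoulli_field r. exp (\<beta> * multiple_sum p N \<sigma>)) = (\<Prod>i\<in>chain_roots p N. chain_Z r \<beta> (chain_len p N i))"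
  unfolding multiple_sum_chains bernoulli_field_def
proof (rule integral_disjoint_chains)
  show "(pos_indices :: 'd index set) \<noteq> {}" by (auto simp: pos_indices_def)
qed (auto intro: chain_inj simp: chain_pt_in_pos_iff chain_roots_pos)

definition limit_energy :: "real \<Rightarrow> real" where
  "limit_energy \<beta> = (\<Sum>m. chain_density m * ln (chain_Z r \<beta> (Suc m)))"

lemma finite_free_energy_eq:
  "finite_free_energy r p N \<beta> = (\<Sum>m. real (chain_count p N m) / box_volume N * ln (chain_Z r \<beta> (Suc m)))"
proof -
  have "ln (LINT \<sigma>|bernoulli_field r. exp (\<beta> * multiple_sum p N \<sigma>))
      = (\<Sum>m. real (chain_count p N m) * ln (chain_Z r \<beta> (Suc m)))"
    using sum_chain_roots[of "\<lambda>l. ln (chain_Z r \<beta> l)" N] chain_Z_pos[of \<beta>, THEN less_imp_neq, THEN not_sym]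
    by (simp add: integral_multiple_sum ln_prod)
  moreover have "summable (\<lambda>m. real (chain_count p N m) * ln (chain_Z r \<beta> (Suc m)))"
  proof (rule summable_finite)
    show "finite ((\<lambda>i. chain_len p N i - 1) ` chain_roots p N)" by simp
    fix m assume m: "m \<notin> (\<lambda>i. chain_len p N i - 1) ` chain_roots p N"
    have "{i \<in> chain_roots p N. chain_len p N i = Suc m} = {}"
    proof safe
      fix i assume "i \<in> chain_roots p N" "chain_len p N i = Suc m"
      then have "m \<in> (\<lambda>i. chain_len p N i - 1) ` chain_roots p N" by (force intro: image_eqI[of _ _ i])
      then show "i \<in> {}" using m by simp
    qed
    then show "real (chain_count p N m) * ln (chain_Z r \<beta> (Suc m)) = 0" by (simp add: chain_count_def)
  qed
  ultimately show ?thesis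
    using suminf_divide[of "\<lambda>m. real (chain_count p N m) * ln (chain_Z r \<beta> (Suc m))" "box_volume N"]
    by (simp add: finite_free_energy_def)
qed

lemma summable_Suc_mult_geometric: "summable (\<lambda>m. real (Suc m) * (1 / index_prod p) ^ m)"
  using geometric_deriv_sums[of "1 / index_prod p"] index_prod_ge_2 by (auto simp: sums_iff)

text \<open>Tannery's theorem: the density bound times the bound on the logarithm is a summable
  majorant that does not involve \<open>N\<close>.\<close>

lemma finite_free_energy_tendsto:
  "((\<lambda>N. finite_free_energy r p N \<beta>) \<longlongrightarrow> limit_energy \<beta>) boxes_at_top"
  unfolding finite_free_energy_eq limit_energy_def
proof (rule tannerys_theorem[THEN conjunct2, THEN conjunct2])
  show "((\<lambda>N. real (chain_count p N m) / box_volume N * ln (chain_Z r \<beta> (Suc m)))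
      \<longlongrightarrow> chain_density m * ln (chain_Z r \<beta> (Suc m))) boxes_at_top" for m
    by (intro tendsto_intros chain_density_tendsto)
  show "summable (\<lambda>m. \<bar>\<beta>\<bar> * (real (Suc m) * (1 / index_prod p) ^ m))"
    by (intro summable_mult summable_Suc_mult_geometric)
  have "norm (real (chain_count p N m) / box_volume N * ln (chain_Z r \<beta> (Suc m)))
      \<le> \<bar>\<beta>\<bar> * (real (Suc m) * (1 / index_prod p) ^ m)" for m N
  proof -
    have "0 \<le> box_volume N" unfolding box_volume_def by (intro prod_nonneg) auto
    then have "norm (real (chain_count p N m) / box_volume N * ln (chain_Z r \<beta> (Suc m)))
        = real (chain_count p N m) / box_volume N * \<bar>ln (chain_Z r \<beta> (Suc m))\<bar>"
      by (simp add: abs_mult)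
    also have "\<dots> \<le> (1 / index_prod p) ^ m * (real (Suc m) * \<bar>\<beta>\<bar>)"
      using index_prod_ge_2 by (intro mult_mono chain_density_bound ln_chain_Z_bound) auto
    finally show ?thesis by (simp only: mult_ac)
  qed
  then show "eventually (\<lambda>(m, N). norm (real (chain_count p N m) / box_volume N * ln (chain_Z r \<beta> (Suc m)))
      \<le> \<bar>\<beta>\<bar> * (real (Suc m) * (1 / index_prod p) ^ m)) (at_top \<times>\<^sub>F boxes_at_top)"
    by (intro always_eventually) auto
qed (rule boxes_at_top_nontrivial)

lemma free_energy_eq: "free_energy r p = limit_energy"
  unfolding free_energy_def fun_eq_iff
  using tendsto_Lim[OF boxes_at_top_nontrivial finite_free_energy_tendsto] by blast

lemma limit_energy_summable: "summable (\<lambda>m. chain_density m * ln (chain_Z r \<beta> (Suc m)))"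
proof (rule summable_comparison_test)
  show "summable (\<lambda>m. \<bar>\<beta>\<bar> * (real (Suc m) * chain_density m))"
    using chain_density_mean by (intro summable_mult) (auto simp: sums_iff)
  have "norm (chain_density m * ln (chain_Z r \<beta> (Suc m))) \<le> \<bar>\<beta>\<bar> * (real (Suc m) * chain_density m)" for m
    using mult_left_mono[OF ln_chain_Z_bound[of \<beta> "Suc m"] chain_density_nonneg[of m]]
    by (simp add: abs_mult chain_density_nonneg mult_ac)
  then show "\<exists>M. \<forall>m\<ge>M. norm (chain_density m * ln (chain_Z r \<beta> (Suc m))) \<le> \<bar>\<beta>\<bar> * (real (Suc m) * chain_density m)"
    by blast
qed

text \<open>The series \<open>chain_density_mean\<close> dominates the derivatives on the whole
  line, so the Weierstrass test allows termwise differentiation.\<close>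

lemma limit_energy_differentiable: "limit_energy differentiable (at \<beta>)"
proof -
  define f' where "f' m = deriv (\<lambda>\<beta>. ln (chain_Z r \<beta> (Suc m)))" for m
  have f': "((\<lambda>\<beta>. ln (chain_Z r \<beta> (Suc m))) has_real_derivative f' m \<beta>) (at \<beta>)"
      "\<bar>f' m \<beta>\<bar> \<le> real (Suc m)" for m \<beta>
    using ln_chain_Z_deriv[of "Suc m" \<beta>] DERIV_imp_deriv unfolding f'_def by (blast, metis)
  have "((\<lambda>\<beta>. \<Sum>m. chain_density m * ln (chain_Z r \<beta> (Suc m))) has_field_derivative
      (\<Sum>m. chain_density m * f' m \<beta>)) (at \<beta>)"
  proof (rule has_field_derivative_series'(2))
    show "convex (UNIV :: real set)" by simp
    show "((\<lambda>\<beta>. chain_density m * ln (chain_Z r \<beta> (Suc m))) has_field_derivative chain_density m * f' m x)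
        (at x within UNIV)" for m x
      by (intro DERIV_cmult f'(1))
    have "norm (chain_density m * f' m x) \<le> real (Suc m) * chain_density m" for m x
      using mult_left_mono[OF f'(2) chain_density_nonneg[of m], of m x]
      by (simp add: abs_mult chain_density_nonneg mult_ac)
    then have "uniform_limit UNIV (\<lambda>n x. \<Sum>m<n. chain_density m * f' m x) (\<lambda>x. \<Sum>m. chain_density m * f' m x) sequentially"
      using chain_density_mean by (intro Weierstrass_m_test) (auto simp: sums_iff)
    then show "uniformly_convergent_on UNIV (\<lambda>n x. \<Sum>m<n. chain_density m * f' m x)"
      by (auto simp: uniformly_convergent_on_def)
  qed (auto intro: limit_energy_summable)
  then show ?thesis
    unfolding limit_energy_def[abs_def] real_differentiable_def by blast
qed

end

section \<open>The closed form of the free energy\<close>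

text \<open>Trace and, in the next lemma, determinant of the transfer matrix. The spectral
  decomposition and the recurrence below use \<Lambda>_- only through them.\<close>

lemma Lambda_sum: "Lambda_plus h \<beta> + Lambda_minus h \<beta> = exp (\<beta> + h) + exp (\<beta> - h)"
proof -
  have "Lambda_plus h \<beta> + Lambda_minus h \<beta> = exp \<beta> * (2 * cosh h)"
    by (simp add: Lambda_plus_def Lambda_minus_def algebra_simps)
  also have "\<dots> = exp \<beta> * (exp h + exp (- h))" by (simp add: cosh_def)
  also have "\<dots> = exp (\<beta> + h) + exp (\<beta> - h)" by (simp add: distrib_left flip: exp_add)
  finally show ?thesis .
qed

lemma Lambda_prod: "Lambda_plus h \<beta> * Lambda_minus h \<beta> = exp (\<beta> + h) * exp (\<beta> - h) - exp (- \<beta>) ^ 2"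
proof -
  let ?s = "sqrt ((sinh h)^2 + exp (- 4 * \<beta>))"
  have "?s ^ 2 = (sinh h)^2 + exp (- 4 * \<beta>)" by simp
  then have "Lambda_plus h \<beta> * Lambda_minus h \<beta> = exp \<beta> ^ 2 * (cosh h ^ 2 - sinh h ^ 2 - exp (- 4 * \<beta>))"
    unfolding Lambda_plus_def Lambda_minus_def by algebra
  also have "\<dots> = exp \<beta> ^ 2 - exp \<beta> ^ 2 * exp (- 4 * \<beta>)"
    by (simp add: cosh_square_eq algebra_simps)
  also have "\<dots> = exp (\<beta> + h) * exp (\<beta> - h) - exp (- \<beta>) ^ 2"
    by (simp add: power2_eq_square flip: exp_add)
  finally show ?thesis .
qed

lemma Lambda_plus_pos: "0 < Lambda_plus h \<beta>"
  unfolding Lambda_plus_def by (intro mult_pos_pos add_pos_nonneg cosh_real_pos) auto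

text \<open>The right-hand side is the squared norm of v, so
  \<open>2 * cosh h - overlap h \<beta>\<close> is the squared component of v along the other
  eigenvector.\<close>

lemma cosh_eq_exp_sum: "2 * cosh h = exp (h / 2) ^ 2 + exp (- h / 2) ^ 2" for h :: real
  by (simp add: cosh_def power2_eq_square flip: exp_add)

definition overlap :: "real \<Rightarrow> real \<Rightarrow> real" where
  "overlap h \<beta> = \<bar>v_vec h \<bullet> e_plus h \<beta>\<bar>^2"

lemma overlap_eq:
  "overlap h \<beta> = (exp (h / 2) * - exp (- \<beta>) + exp (- h / 2) * (exp (h + \<beta>) - Lambda_plus h \<beta>))^2
      / (exp (- \<beta>)^2 + (exp (h + \<beta>) - Lambda_plus h \<beta>)^2)"
proof -
  have "norm (w_plus h \<beta>) ^ 2 = w_plus h \<beta> \<bullet> w_plus h \<beta>" by (rule power2_norm_eq_inner)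
  then have n: "norm (w_plus h \<beta>) ^ 2 = exp (- \<beta>)^2 + (exp (h + \<beta>) - Lambda_plus h \<beta>)^2"
    by (simp add: w_plus_def inner_vec_def sum_2 power2_eq_square)
  have "v_vec h \<bullet> w_plus h \<beta> = exp (h / 2) * - exp (- \<beta>) + exp (- h / 2) * (exp (h + \<beta>) - Lambda_plus h \<beta>)"
    by (simp add: w_plus_def v_vec_def inner_vec_def sum_2)
  moreover have "overlap h \<beta> = (v_vec h \<bullet> w_plus h \<beta>)^2 / norm (w_plus h \<beta>) ^ 2"
    by (simp add: overlap_def e_plus_def power_mult_distrib divide_inverse power_inverse)
  ultimately show ?thesis by (simp only: n)
qed

lemma Lambda_plus_gt: "exp (h + \<beta>) < Lambda_plus h \<beta>"
proof -
  have "sinh h < sqrt ((sinh h)^2 + exp (- 4 * \<beta>))"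
    by (rule order.strict_trans1[OF abs_ge_self]) (simp add: real_less_rsqrt)
  then have "exp \<beta> * (cosh h + sinh h) < Lambda_plus h \<beta>"
    unfolding Lambda_plus_def by simp
  then show ?thesis by (simp add: cosh_plus_sinh exp_add mult.commute)
qed

text \<open>Perron-Frobenius by hand: both components of \<open>w_plus\<close> are negative and
  those of \<open>v_vec\<close> positive, so the inner product cannot vanish.\<close>

lemma overlap_pos: "0 < overlap h \<beta>"
proof -
  have "exp (h / 2) * - exp (- \<beta>) + exp (- h / 2) * (exp (h + \<beta>) - Lambda_plus h \<beta>) < 0"
    using Lambda_plus_gt[of h \<beta>] by (intro add_neg_neg) (auto simp: mult_pos_neg)
  then show ?thesis unfolding overlap_eq
    by (intro divide_pos_pos add_pos_nonneg) auto
qed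

text \<open>Spectral decomposition of \<open>v\<^sup>T M v\<close> for the transfer matrix \<open>M\<close>: the vector \<open>(w\<^sub>2, - w\<^sub>1)\<close>
  orthogonal to \<open>w\<^sub>+\<close> is an eigenvector for \<open>\<Lambda>\<^sub>-\<close>.\<close>

lemma transfer_matrix_form:
  "overlap h \<beta> * Lambda_plus h \<beta> + (2 * cosh h - overlap h \<beta>) * Lambda_minus h \<beta>
     = exp (h / 2)^2 * exp (h + \<beta>) + 2 * (exp (h / 2) * exp (- h / 2)) * exp (- \<beta>) + exp (- h / 2)^2 * exp (\<beta> - h)"
proof -
  define a b d v w L L' K W where defs: "a = exp (h + \<beta>)" "b = exp (- \<beta>)" "d = exp (\<beta> - h)"
    "v = exp (h / 2)" "w = exp (- h / 2)" "L = Lambda_plus h \<beta>" "L' = Lambda_minus h \<beta>" "K = overlap h \<beta>"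
    "W = b^2 + (a - L)^2"
  have W: "W > 0" by (simp add: defs add_pos_nonneg)
  have K: "K * W = (v * - b + w * (a - L))^2"
    using W by (simp add: defs overlap_eq)
  have sum: "L + L' = a + d" and prod: "L * L' = a * d - b^2"
    using Lambda_sum[of h \<beta>] Lambda_prod[of h \<beta>] by (simp_all add: defs add.commute)
  \<comment> \<open>Once multiplied by the squared norm \<open>W\<close>, the claim is a polynomial
    consequence of the trace, the determinant and the formula for \<open>K * W\<close>.\<close>
  have "W * (K * L + (v^2 + w^2 - K) * L') = W * (v^2 * a + 2 * (v * w) * b + w^2 * d)"
    using K sum prod defs(9) by algebra
  then have "K * L + (v^2 + w^2 - K) * L' = v^2 * a + 2 * (v * w) * b + w^2 * d"
    using W by simp
  then show ?thesis by (simp add: defs cosh_eq_exp_sum)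
qed

section \<open>Partition functions in closed form\<close>

context spin_bias
begin

text \<open>The two spin weights differ from those of an external field only by a common factor, so
  the bias enters the transfer matrix as \<open>h\<close> and one scalar per spin.\<close>

lemma bias_eq:
  "r = sqrt (r * (1 - r)) * exp (ext_field r)" "1 - r = sqrt (r * (1 - r)) * exp (- ext_field r)"
proof -
  have e: "exp (ext_field r) ^ 2 = r / (1 - r)"
  proof -
    have "exp (2 * ext_field r) = r / (1 - r)" using r_pos r_less_1 by (simp add: ext_field_def)
    then show ?thesis by (simp only: exp_double)
  qed
  have q: "sqrt (r * (1 - r)) ^ 2 = r * (1 - r)" using r_pos r_less_1 by simp
  have "r ^ 2 = (sqrt (r * (1 - r)) * exp (ext_field r)) ^ 2"
    unfolding power_mult_distrib q e using r_less_1 by (simp add: power2_eq_square)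
  then show "r = sqrt (r * (1 - r)) * exp (ext_field r)"
    by (rule power2_eq_imp_eq) (use r_pos r_less_1 in auto)
  have "(1 - r) ^ 2 = (sqrt (r * (1 - r)) * exp (- ext_field r)) ^ 2"
    unfolding power_mult_distrib q exp_minus power_inverse e using r_pos by (simp add: power2_eq_square)
  then show "1 - r = sqrt (r * (1 - r)) * exp (- ext_field r)"
    by (rule power2_eq_imp_eq) (use r_pos r_less_1 in auto)
qed

text \<open>Cayley-Hamilton for the 2 by 2 matrix that advances \<open>chain_weight\<close>: the
  coefficients are its trace and determinant.\<close>

lemma chain_Z_recurrence:
  "chain_Z r \<beta> (Suc (Suc l)) = (r * exp \<beta> + (1 - r) * exp \<beta>) * chain_Z r \<beta> (Suc l)
     - (r * exp \<beta> * ((1 - r) * exp \<beta>) - r * exp (- \<beta>) * ((1 - r) * exp (- \<beta>))) * chain_Z r \<beta> l"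
  unfolding chain_Z_def by (simp add: algebra_simps)

text \<open>Both sides satisfy the same second-order recurrence. The start \<open>l = 0\<close> is
  normalisation of the spin law, and \<open>l = 1\<close> is \<open>transfer_matrix_form\<close>.
  The exponent \<open>Suc l\<close> counts spins, not bonds.\<close>

lemma chain_Z_closed_form:
  defines "h \<equiv> ext_field r"
  shows "chain_Z r \<beta> l = sqrt (r * (1 - r)) ^ Suc l *
    (overlap h \<beta> * Lambda_plus h \<beta> ^ l + (2 * cosh h - overlap h \<beta>) * Lambda_minus h \<beta> ^ l)"
proof -
  define q where "q = sqrt (r * (1 - r))"
  define L L' where "L = Lambda_plus h \<beta>" "L' = Lambda_minus h \<beta>"
  note r1 = bias_eq(1)[folded q_def h_def] and r2 = bias_eq(2)[folded q_def h_def]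
  have A: "r * exp \<beta> = q * exp (\<beta> + h)" and D: "(1 - r) * exp \<beta> = q * exp (\<beta> - h)"
    using arg_cong[OF r1, of "\<lambda>z. z * exp \<beta>"] arg_cong[OF r2, of "\<lambda>z. z * exp \<beta>"]
    by (simp_all add: diff_conv_add_uminus exp_add mult_ac del: add_uminus_conv_diff)
  have rr: "r * (1 - r) = q^2" using r_pos r_less_1 by (simp add: q_def)
  have BC: "r * exp (- \<beta>) * ((1 - r) * exp (- \<beta>)) = q^2 * exp (- \<beta>) ^ 2"
    unfolding rr[symmetric] by (simp add: power2_eq_square)
  have rec: "chain_Z r \<beta> (Suc (Suc l)) = q * (L + L') * chain_Z r \<beta> (Suc l) - q^2 * (L * L') * chain_Z r \<beta> l" for l
    unfolding chain_Z_recurrence A D BC L_L'_def Lambda_sum Lambda_prod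
    by (simp add: algebra_simps power2_eq_square)
  show ?thesis
    unfolding q_def[symmetric] L_L'_def[symmetric]
  proof (induction l rule: induct_nat_012)
    case 0
    have "q * (2 * cosh h) = q * exp h + q * exp (- h)" by (simp add: cosh_def algebra_simps)
    also have "\<dots> = 1" by (simp only: r1[symmetric] r2[symmetric])
    finally have "q * (2 * cosh h) = 1" .
    then show ?case by (simp add: chain_Z_def)
  next
    case 1
    have "chain_Z r \<beta> (Suc 0) = r * (r * exp \<beta>) + 2 * (r * (1 - r)) * exp (- \<beta>) + (1 - r) * ((1 - r) * exp \<beta>)"
      by (simp add: chain_Z_def algebra_simps)
    also note rr
    also have "r * (r * exp \<beta>) = q^2 * (exp (h / 2)^2 * exp (h + \<beta>))"
    proof -
      have "r * (r * exp \<beta>) = (q * exp h) * (q * exp (\<beta> + h))" by (simp only: A r1[symmetric])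
      also have "\<dots> = q^2 * (exp (h / 2)^2 * exp (h + \<beta>))"
        by (simp add: power2_eq_square add.commute mult_ac flip: exp_add)
      finally show ?thesis .
    qed
    also have "(1 - r) * ((1 - r) * exp \<beta>) = q^2 * (exp (- h / 2)^2 * exp (\<beta> - h))"
    proof -
      have "(1 - r) * ((1 - r) * exp \<beta>) = (q * exp (- h)) * (q * exp (\<beta> - h))" by (simp only: D r2[symmetric])
      also have "\<dots> = q^2 * (exp (- h / 2)^2 * exp (\<beta> - h))"
        by (simp add: power2_eq_square mult_ac flip: exp_add)
      finally show ?thesis .
    qed
    also have "q^2 * (exp (h / 2)^2 * exp (h + \<beta>)) + 2 * q^2 * exp (- \<beta>) + q^2 * (exp (- h / 2)^2 * exp (\<beta> - h))
       = q^2 * (overlap h \<beta> * L + (2 * cosh h - overlap h \<beta>) * L')"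
    proof -
      have "exp (h / 2) * exp (- h / 2) = 1" by (simp flip: exp_add)
      then show ?thesis unfolding L_L'_def transfer_matrix_form by (simp add: algebra_simps)
    qed
    finally show ?case by (simp add: power2_eq_square)
  next
    case (ge2 l)
    show ?case unfolding rec ge2 by (simp add: algebra_simps power2_eq_square)
  qed
qed

lemma ln_chain_Z:
  defines "h \<equiv> ext_field r"
  shows "ln (chain_Z r \<beta> l) = (real l + 1) / 2 * ln (r * (1 - r)) + ln (overlap h \<beta>) + real l * ln (Lambda_plus h \<beta>)
    + ln (1 + (2 * cosh h / overlap h \<beta> - 1) * (Lambda_minus h \<beta> / Lambda_plus h \<beta>) ^ l)"
proof -
  let ?K = "overlap h \<beta>" and ?L = "Lambda_plus h \<beta>" and ?L' = "Lambda_minus h \<beta>" and ?q = "sqrt (r * (1 - r))"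
  let ?T = "1 + (2 * cosh h / ?K - 1) * (?L' / ?L) ^ l"
  have K: "?K > 0" and L: "?L > 0" by (rule overlap_pos, rule Lambda_plus_pos)
  have q: "?q > 0" using r_pos r_less_1 by simp
  have Z: "chain_Z r \<beta> l = ?q ^ Suc l * (?K * ?L ^ l * ?T)"
    unfolding chain_Z_closed_form[of \<beta> l, folded h_def]
    using K L by (simp add: field_simps)
  \<comment> \<open>\<Lambda>_- is negative for \<open>\<beta> < 0\<close>, so positivity of
    \<open>?T\<close> is read off from that of the partition function.\<close>
  then have "?q ^ Suc l * (?K * ?L ^ l) * ?T > 0"
    using chain_Z_pos[of \<beta> l] by (simp add: mult.assoc)
  then have T: "?T > 0"
    by (rule zero_less_mult_pos) (intro mult_pos_pos zero_less_power q K L)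
  have "ln (chain_Z r \<beta> l) = real (Suc l) * ln ?q + (ln ?K + real l * ln ?L + ln ?T)"
    unfolding Z using q K L T by (simp only: ln_mult_pos ln_realpow zero_less_power mult_pos_pos)
  also have "ln ?q = ln (r * (1 - r)) / 2"
    using r_pos r_less_1 by (simp add: ln_sqrt)
  finally show ?thesis by (simp add: algebra_simps)
qed

end

section \<open>The limiting free energy in closed form and its large deviations\<close>

context multiple_spin
begin

lemma limit_energy_closed_form:
  defines "h \<equiv> ext_field r"
  shows "summable (\<lambda>l. G_term r p \<beta> (Suc l))"
    and "limit_energy \<beta> = (2 * index_prod p - 1) / (2 * index_prod p) * ln (r * (1 - r))
          + (index_prod p - 1) / index_prod p * ln (overlap h \<beta>)
          + ln (Lambda_plus h \<beta>) + G_series r p \<beta>"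
proof -
  let ?P = "index_prod p"
  let ?lr = "ln (r * (1 - r))" and ?lK = "ln (overlap h \<beta>)" and ?lL = "ln (Lambda_plus h \<beta>)"
  \<comment> \<open>The term is what remains of \<open>ln (chain_Z r \<beta> (Suc m))\<close> after
    removing its part affine in the number of bonds. That part sums explicitly by the mean length
    and the total density of chains.\<close>
  have G: "G_term r p \<beta> (Suc m) = chain_density m * ln (chain_Z r \<beta> (Suc m))
      - ((?lr / 2 + ?lL) * (real (Suc m) * chain_density m) + (?lr / 2 + ?lK) * chain_density m)" for m
    unfolding ln_chain_Z G_term_def Let_def chain_density_def overlap_def h_def
    by (simp add: algebra_simps add_divide_distrib)
  have lin: "(\<lambda>m. (?lr / 2 + ?lL) * (real (Suc m) * chain_density m) + (?lr / 2 + ?lK) * chain_density m)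
      sums ((?lr / 2 + ?lL) * 1 + (?lr / 2 + ?lK) * ((?P - 1) / ?P))"
    by (intro sums_add sums_mult chain_density_mean chain_density_sums)
  have "(\<lambda>m. G_term r p \<beta> (Suc m)) sums
      (limit_energy \<beta> - ((?lr / 2 + ?lL) * 1 + (?lr / 2 + ?lK) * ((?P - 1) / ?P)))"
    unfolding G limit_energy_def by (intro sums_diff lin summable_sums limit_energy_summable)
  then have G_sum: "summable (\<lambda>l. G_term r p \<beta> (Suc l))"
    "G_series r p \<beta> = limit_energy \<beta> - ((?lr / 2 + ?lL) * 1 + (?lr / 2 + ?lK) * ((?P - 1) / ?P))"
    by (simp_all only: sums_iff G_series_def)
  show "summable (\<lambda>l. G_term r p \<beta> (Suc l))" by (rule G_sum(1))
  \<comment> \<open>A chain has one more spin than bonds, so there are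
    \<open>1 + (P - 1) / P\<close> spins per site, each contributing half of
    \<open>ln (r * (1 - r))\<close>.\<close>
  have e: "(2 * ?P - 1) / (2 * ?P) = (1 + (?P - 1) / ?P) / 2"
    using index_prod_ge_2 by (simp add: field_simps)
  have split: "E = (1 + \<kappa>) / 2 * A + \<kappa> * B + C + (E - ((A / 2 + C) * 1 + (A / 2 + B) * \<kappa>))"
    for E \<kappa> A B C :: real by (simp add: field_simps)
  show "limit_energy \<beta> = (2 * ?P - 1) / (2 * ?P) * ?lr + (?P - 1) / ?P * ?lK + ?lL + G_series r p \<beta>"
    unfolding G_sum(2) e by (rule split)
qed

lemma prob_space_bernoulli_field: "prob_space (bernoulli_field r :: ('d index \<Rightarrow> real) measure)"
  unfolding bernoulli_field_def by (rule prob_space_spins)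

lemma scaled_index_pos: "i \<in> index_box N \<Longrightarrow> (\<lambda>j. p j * i j) \<in> pos_indices"
  using chain_pt_in_pos_iff[of i 1] index_box_subset_pos[of N] by (auto simp: chain_pt_def)

lemma multiple_average_measurable: "multiple_average p N \<in> borel_measurable (bernoulli_field r)"
  unfolding multiple_average_def[abs_def] multiple_sum_def bernoulli_field_def
  using index_box_subset_pos[of N] scaled_index_pos
  by (intro borel_measurable_divide borel_measurable_sum borel_measurable_times borel_measurable_const
      measurable_spin_coordinate) auto

lemma abs_multiple_sum_le:
  assumes "\<sigma> \<in> space (bernoulli_field r)"
  shows "\<bar>multiple_sum p N \<sigma>\<bar> \<le> box_volume N"
proof -
  have abs1: "\<bar>\<sigma> i\<bar> = 1" if "i \<in> pos_indices" for i
  proof -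
    have "\<sigma> i \<in> {1, -1}"
      using assms that unfolding bernoulli_field_def by (auto simp: space_PiM PiE_iff)
    then show ?thesis by auto
  qed
  have "\<bar>multiple_sum p N \<sigma>\<bar> \<le> (\<Sum>i\<in>index_box N. \<bar>\<sigma> i * \<sigma> (\<lambda>j. p j * i j)\<bar>)"
    unfolding multiple_sum_def by (rule sum_abs)
  also have "\<dots> = (\<Sum>i\<in>index_box N. 1)"
    using index_box_subset_pos[of N] scaled_index_pos by (intro sum.cong refl) (auto simp: abs_mult abs1)
  also have "\<dots> = box_volume N" by (simp add: card_index_box box_volume_def)
  finally show ?thesis .
qed

text \<open>An empty box has volume 0 and an empty sum, so the identity covers every
  \<open>N\<close> despite the division.\<close>

lemma box_volume_mult_average: "box_volume N * multiple_average p N \<sigma> = multiple_sum p N \<sigma>"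
proof (cases "box_volume N = 0")
  case True
  then have "card (index_box N) = 0"
    by (simp add: card_index_box box_volume_def)
  then show ?thesis by (simp add: True multiple_sum_def)
qed (simp add: multiple_average_def)

sublocale gartner_ellis "bernoulli_field r" boxes_at_top box_volume "multiple_average p" limit_energy
proof (intro gartner_ellis.intro gartner_ellis_axioms.intro)
  show "\<bar>multiple_average p N \<sigma>\<bar> \<le> 1" if "\<sigma> \<in> space (bernoulli_field r)" for N \<sigma>
  proof -
    have "\<bar>multiple_average p N \<sigma>\<bar> = \<bar>multiple_sum p N \<sigma>\<bar> / \<bar>box_volume N\<bar>"
      by (simp add: multiple_average_def)
    also have "\<dots> \<le> 1"
      using abs_multiple_sum_le[OF that, of N] by (cases "box_volume N = 0") (auto simp: divide_le_eq_1)
    finally show ?thesis .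
  qed
  show "((\<lambda>N. ln (LINT \<sigma>|bernoulli_field r. exp (\<beta> * (box_volume N * multiple_average p N \<sigma>))) / box_volume N)
      \<longlongrightarrow> limit_energy \<beta>) boxes_at_top" for \<beta>
    using finite_free_energy_tendsto[of \<beta>] by (simp add: box_volume_mult_average finite_free_energy_def)
qed (rule prob_space_bernoulli_field boxes_at_top_nontrivial filterlim_box_volume
    multiple_average_measurable limit_energy_differentiable)+

lemma window_rate_tendsto:
  "eventually (\<lambda>\<epsilon>. (window_rate r p x \<epsilon> \<longlongrightarrow> (INF y\<in>{x - \<epsilon>..x + \<epsilon>}. legendre limit_energy y)) boxes_at_top)
     (at_right 0)"
  using eventually_window_limit[of x] by (simp add: window_rate_def[abs_def])

lemma window_rate_limit_eq:
  "eventually (\<lambda>\<epsilon>. window_rate_limit r p x \<epsilon> = (INF y\<in>{x - \<epsilon>..x + \<epsilon>}. legendre limit_energy y)) (at_right 0)"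
  using window_rate_tendsto[of x]
  by eventually_elim (simp add: window_rate_limit_def tendsto_Lim boxes_at_top_nontrivial)

lemma window_rate_limit_tendsto: "(window_rate_limit r p x \<longlongrightarrow> legendre limit_energy x) (at_right 0)"
  using INF_window_tendsto[of x] tendsto_cong[OF window_rate_limit_eq[of x]] by blast

lemma rate_function_eq: "rate_function r p = legendre limit_energy"
  unfolding rate_function_def fun_eq_iff
  using tendsto_Lim[OF trivial_limit_at_right_real window_rate_limit_tendsto] by blast

end

theorem theorem3p2:
  fixes p :: "'d::finite \<Rightarrow> nat" and r :: real
  assumes p_pos: "\<forall>j. p j \<ge> 1"
    and p_coprime: "\<forall>i j. i \<noteq> j \<longrightarrow> gcd (p i) (p j) = 1"
    and p_prod: "(\<Prod>j\<in>UNIV. p j) \<ge> 2"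
    and r: "0 < r" "r < 1"
  shows
    "(\<forall>\<beta>.
        ((\<lambda>N. finite_free_energy r p N \<beta>) \<longlongrightarrow> free_energy r p \<beta>) boxes_at_top \<and>
        summable (\<lambda>l. G_term r p \<beta> (Suc l)) \<and>
        free_energy r p \<beta> =
          (2 * index_prod p - 1) / (2 * index_prod p) * ln (r * (1 - r))
          + (index_prod p - 1) / index_prod p
              * ln (\<bar>v_vec (ext_field r) \<bullet> e_plus (ext_field r) \<beta>\<bar>^2)
          + ln (Lambda_plus (ext_field r) \<beta>)
          + G_series r p \<beta>) \<and>
     (\<forall>\<beta>. free_energy r p differentiable (at \<beta>)) \<and>
     (\<forall>x.
        (\<forall>\<^sub>F \<epsilon> in at_right 0.
            (window_rate r p x \<epsilon> \<longlongrightarrow> window_rate_limit r p x \<epsilon>) boxes_at_top) \<and>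
        (window_rate_limit r p x \<longlongrightarrow> rate_function r p x) (at_right 0)) \<and>
     large_deviation_principle boxes_at_top box_volume (bernoulli_field r)
       (multiple_average p) (rate_function r p) \<and>
     (\<forall>x. rate_function r p x = (SUP \<beta>. ereal (\<beta> * x - free_energy r p \<beta>))) \<and>
     (\<forall>\<eta> y. (free_energy r p has_real_derivative y) (at \<eta>) \<longrightarrow>
        rate_function r p y = ereal (\<eta> * y - free_energy r p \<eta>))"
proof -
  interpret multiple_spin p r
    using p_pos p_prod r by unfold_locales auto
  have window: "\<forall>\<^sub>F \<epsilon> in at_right 0. (window_rate r p x \<epsilon> \<longlongrightarrow> window_rate_limit r p x \<epsilon>) boxes_at_top" for x
    using window_rate_tendsto[of x] window_rate_limit_eq[of x] by eventually_elim simp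
  show ?thesis
    unfolding free_energy_eq rate_function_eq
  proof (intro conjI allI impI)
    show "limit_energy \<beta> =
          (2 * index_prod p - 1) / (2 * index_prod p) * ln (r * (1 - r))
          + (index_prod p - 1) / index_prod p
              * ln (\<bar>v_vec (ext_field r) \<bullet> e_plus (ext_field r) \<beta>\<bar>^2)
          + ln (Lambda_plus (ext_field r) \<beta>)
          + G_series r p \<beta>" for \<beta>
      using limit_energy_closed_form(2)[of \<beta>] by (simp only: overlap_def)
    show "legendre limit_energy x = (SUP \<beta>. ereal (\<beta> * x - limit_energy \<beta>))" for x
      by (rule legendre_def)
  qed (rule finite_free_energy_tendsto limit_energy_closed_form(1) limit_energy_differentiable window
      window_rate_limit_tendsto ldp legendre_at_derivative; assumption?)+
qed

end
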